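(* Assume that $8\zeta(\sigma)\le\sqrt n$, $0<\sigma\le s_4^2$ and $\kappa\ge 3/2$. Then with probability at least $1-2\epsilon$, for any $L>0$ and any $1/L$-Lipschitz function $f:\mathbb R\to\mathbb R$, $$\|f(G)-f(\widehat G)\|_\infty\le\min_{r\in\{1,\dots,d\}}L^{-1}\left(B(\lambda_1)+\sqrt{4rB(\lambda_1)^2+2\sum_{i=r+1}^d\lambda_i^2}\;\right).$$
   Context: Let $X\in\mathbb R^d$ be a random vector with $\mathbb E\|X\|^4<\infty$, $X_1,\dots,X_n$ an i.i.d. sample with the law of $X$, and $G=\mathbb E(XX^\top)$ its Gram matrix. $\mathbb S_d=\{\theta\in\mathbb R^d:\|\theta\|=1\}$, $\|M\|_F=\mathrm{Tr}(M^\top M)^{1/2}$, and $\|\cdot\|_\infty$ is the operator norm. For a symmetric matrix $M=U\,\mathrm{diag}(\mu_1,\dots,\mu_d)\,U^\top$ with $U$ orthogonal, $f(M)=U\,\mathrm{diag}(f(\mu_1),\dots,f(\mu_d))\,U^\top$. Fix $a>0$, $\delta>0$, $\epsilon\in(0,1)$ and a threshold $\sigma\in(0,s_4^2]$, where $s_4^2=\mathbb E(\|X\|^4)^{1/2}$. Put $$\kappa=\sup_{\theta\in\mathbb R^d,\ \mathbb E(\langle\theta,X\rangle^2)>0}\frac{\mathbb E(\langle\theta,X\rangle^4)}{\mathbb E(\langle\theta,X\rangle^2)^2},\qquad c=\frac{15}{8\log(2)(\sqrt2-1)}\exp\Bigl(\frac{1+2\sqrt2}{2}\Bigr),$$ $$K=1+\Bigl\lceil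 a^{-1}\log\Bigl(\frac{n}{72(2+c)\kappa^{1/2}}\Bigr)\Bigr\rceil,$$ $$\zeta(t)=\sqrt{2(\kappa-1)\Bigl(\frac{(2+3c)s_4^2}{4(2+c)\kappa^{1/2}t}+\log(K/\epsilon)\Bigr)}\cosh(a/4)+\sqrt{\frac{2(2+c)\kappa^{1/2}s_4^2}{t}}\cosh(a/2),$$ $$B_*(t)=\begin{cases}\dfrac{n^{-1/2}\zeta(\max\{t,\sigma\})}{1-4n^{-1/2}\zeta(\max\{t,\sigma\})} & \text{if }[6+(\kappa-1)^{-1}]\,\zeta(\max\{t,\sigma\})\le\sqrt n,\\ +\infty&\text{otherwise,}\end{cases}$$ $$B(t)=2\max\{t,\sigma\}B_*(\min\{t,s_4^2\})+7\delta\|G\|_F+\sigma.$$ Estimator. $Q$ is a random symmetric $d\times d$ matrix (a function of the sample), $Q=Q_+-Q_-$ is its decomposition into positive and negative parts, and $\widehat G=Q_+$. The estimator $Q$ has the following property (when $8\zeta(\sigma)\le\sqrt n$, $\sigma\le s_4^2$, $\kappa\ge3/2$): there is an event of probability at least $1-2\epsilon$ on which, for every $\theta\in\mathbb S_d$, $\bigl|\max\{\theta^\top Q\theta,\sigma\}-\max\{\theta^\top G\theta,\sigma\}\bigr|$ is at most each of $$2\max\{\theta^\top G\theta,\sigma\}B_*(\theta^\top G\theta)+5\delta\|G\|_F,\qquad 2\max\{\theta^\top Q\theta,\sigma\}B_*(\min\{\theta^\top Q\theta,s_4^2\})+5\delta\|G\|_F,$$ and $\bigl|\max\{\theta^\top\widehat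 G\theta,\sigma\}-\max\{\theta^\top G\theta,\sigma\}\bigr|$ is at most each of $$2\max\{\theta^\top G\theta,\sigma\}B_*(\theta^\top G\theta)+7\delta\|G\|_F,\qquad 2\max\{\theta^\top\widehat G\theta,\sigma\}B_*(\min\{\theta^\top\widehat G\theta,s_4^2\})+7\delta\|G\|_F.$$ $\lambda_1\ge\dots\ge\lambda_d$ are the eigenvalues of $G$. *)

theory Defs
  imports "HOL-Probability.Probability" "HOL-Computational_Algebra.Polynomial"
begin

definition frobenius_norm :: "real^'n^'n \<Rightarrow> real" where
  "frobenius_norm A = sqrt (trace (transpose A ** A))"

definition operator_norm :: "real^'n^'n \<Rightarrow> real" where
  "operator_norm A = onorm (\<lambda>v. A *v v)"

definition diag_matrix :: "('n \<Rightarrow> real) \<Rightarrow> real^'n^'n" where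
  "diag_matrix \<mu> = (\<chi> i j. if i = j then \<mu> i else 0)"

text \<open>For a symmetric matrix the spectral theorem provides a decomposition, and the resulting
  matrix does not depend on the decomposition; the choice operator is therefore harmless. For
  matrices that are not orthogonally diagonalizable the value is unspecified.\<close>

definition matrix_fun :: "(real \<Rightarrow> real) \<Rightarrow> real^'n^'n \<Rightarrow> real^'n^'n" where
  "matrix_fun f A = (SOME N. \<exists>U \<mu>. orthogonal_matrix U
      \<and> A = U ** diag_matrix \<mu> ** transpose U
      \<and> N = U ** diag_matrix (\<lambda>i. f (\<mu> i)) ** transpose U)"

definition positive_part :: "real^'n^'n \<Rightarrow> real^'n^'n" where
  "positive_part A = matrix_fun (\<lambda>x. max x 0) A"

definition characteristic_poly :: "real^'n^'n \<Rightarrow> real poly" where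
  "characteristic_poly A = det (\<chi> i j. (if i = j then [:0, 1:] else 0) - [:A $ i $ j:])"

text \<open>Eigenvalues in non-increasing order, repeated according to their multiplicity and indexed
  from 1 to the dimension; meant for symmetric matrices, all of whose eigenvalues are real.\<close>

definition eigenval :: "real^'n^'n \<Rightarrow> nat \<Rightarrow> real" where
  "eigenval A i = rev (sorted_list_of_multiset (proots (characteristic_poly A))) ! (i - 1)"

definition gram :: "'a measure \<Rightarrow> ('a \<Rightarrow> real^'d) \<Rightarrow> real^'d^'d" where
  "gram M X = (\<chi> i j. \<integral>\<omega>. X \<omega> $ i * X \<omega> $ j \<partial>M)"

text \<open>The square is part of the quantity: this is \<open>s\<^sub>4\<^sup>2\<close>, hence a single square root.\<close>

definition s4_sq :: "'a measure \<Rightarrow> ('a \<Rightarrow> real^'d) \<Rightarrow> real" where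
  "s4_sq M X = sqrt (\<integral>\<omega>. norm (X \<omega>) ^ 4 \<partial>M)"

text \<open>The supremum is taken in the reals. If the fourth moment of \<open>X\<close> is finite, the set is bounded
  above (the dimension is finite); it is nonempty unless \<open>X\<close> vanishes almost surely, in
  which case \<open>s4_sq M X = 0\<close>.\<close>

definition kurtosis :: "'a measure \<Rightarrow> ('a \<Rightarrow> real^'d) \<Rightarrow> real" where
  "kurtosis M X =
     (SUP \<theta> \<in> {\<theta>. (\<integral>\<omega>. (\<theta> \<bullet> X \<omega>)\<^sup>2 \<partial>M) > 0}.
        (\<integral>\<omega>. (\<theta> \<bullet> X \<omega>) ^ 4 \<partial>M) / (\<integral>\<omega>. (\<theta> \<bullet> X \<omega>)\<^sup>2 \<partial>M)\<^sup>2)"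

definition c_const :: real where
  "c_const = 15 / (8 * ln 2 * (sqrt 2 - 1)) * exp ((1 + 2 * sqrt 2) / 2)"

definition K_const :: "'a measure \<Rightarrow> ('a \<Rightarrow> real^'d) \<Rightarrow> nat \<Rightarrow> real \<Rightarrow> int" where
  "K_const M X n a =
     1 + \<lceil>inverse a * ln (real n / (72 * (2 + c_const) * sqrt (kurtosis M X)))\<rceil>"

definition zeta :: "'a measure \<Rightarrow> ('a \<Rightarrow> real^'d) \<Rightarrow> nat \<Rightarrow> real \<Rightarrow> real \<Rightarrow> real \<Rightarrow> real" where
  "zeta M X n a \<epsilon> t =
     sqrt (2 * (kurtosis M X - 1) *
         ((2 + 3 * c_const) * s4_sq M X / (4 * (2 + c_const) * sqrt (kurtosis M X) * t)
           + ln (real_of_int (K_const M X n a) / \<epsilon>))) * cosh (a / 4)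
     + sqrt (2 * (2 + c_const) * sqrt (kurtosis M X) * s4_sq M X / t) * cosh (a / 2)"

definition B_star ::
    "'a measure \<Rightarrow> ('a \<Rightarrow> real^'d) \<Rightarrow> nat \<Rightarrow> real \<Rightarrow> real \<Rightarrow> real \<Rightarrow> real \<Rightarrow> ereal" where
  "B_star M X n a \<epsilon> \<sigma> t =
     (let z = zeta M X n a \<epsilon> (max t \<sigma>) in
      if (6 + inverse (kurtosis M X - 1)) * z \<le> sqrt (real n)
      then ereal ((z / sqrt (real n)) / (1 - 4 * (z / sqrt (real n))))
      else \<infinity>)"

definition B_bound ::
    "'a measure \<Rightarrow> ('a \<Rightarrow> real^'d) \<Rightarrow> nat \<Rightarrow> real \<Rightarrow> real \<Rightarrow> real \<Rightarrow> real \<Rightarrow> real \<Rightarrow> ereal" where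
  "B_bound M X n a \<epsilon> \<delta> \<sigma> t =
     ereal (2 * max t \<sigma>) * B_star M X n a \<epsilon> \<sigma> (min t (s4_sq M X))
     + ereal (7 * \<delta> * frobenius_norm (gram M X)) + ereal \<sigma>"

definition ereal_sqrt :: "ereal \<Rightarrow> ereal" where
  "ereal_sqrt x = (if x = \<infinity> then \<infinity> else ereal (sqrt (real_of_ereal x)))"

definition estimator_property ::
    "'a measure \<Rightarrow> ('a \<Rightarrow> real^'d) \<Rightarrow> nat \<Rightarrow> real \<Rightarrow> real \<Rightarrow> real \<Rightarrow> real
      \<Rightarrow> ('a \<Rightarrow> real^'d^'d) \<Rightarrow> bool" where
  "estimator_property M X n a \<epsilon> \<delta> \<sigma> Q \<longleftrightarrow>
    (8 * zeta M X n a \<epsilon> \<sigma> \<le> sqrt (real n) \<and> \<sigma> \<le> s4_sq M X \<and> kurtosis M X \<ge> 3 / 2 \<longrightarrow>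
     (\<exists>A \<in> sets M. measure M A \<ge> 1 - 2 * \<epsilon> \<and>
       (\<forall>\<omega> \<in> A. \<forall>\<theta>. norm \<theta> = 1 \<longrightarrow>
         (let Bs = B_star M X n a \<epsilon> \<sigma>;
              F = frobenius_norm (gram M X);
              g = \<theta> \<bullet> (gram M X *v \<theta>);
              q = \<theta> \<bullet> (Q \<omega> *v \<theta>);
              h = \<theta> \<bullet> (positive_part (Q \<omega>) *v \<theta>)
          in ereal \<bar>max q \<sigma> - max g \<sigma>\<bar> \<le> ereal (2 * max g \<sigma>) * Bs g + ereal (5 * \<delta> * F)
           \<and> ereal \<bar>max q \<sigma> - max g \<sigma>\<bar>
               \<le> ereal (2 * max q \<sigma>) * Bs (min q (s4_sq M X)) + ereal (5 * \<delta> * F)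
           \<and> ereal \<bar>max h \<sigma> - max g \<sigma>\<bar> \<le> ereal (2 * max g \<sigma>) * Bs g + ereal (7 * \<delta> * F)
           \<and> ereal \<bar>max h \<sigma> - max g \<sigma>\<bar>
               \<le> ereal (2 * max h \<sigma>) * Bs (min h (s4_sq M X)) + ereal (7 * \<delta> * F)))))"

end

theory Submission
  imports Defs
begin

text \<open>The estimator property and the monotonicity of \<open>t \<mapsto> max t \<sigma> * B\<^sub>* t\<close> give
  \<open>\<bar>v \<bullet> (H - G) v\<bar> \<le> b \<parallel>v\<parallel>\<^sup>2\<close> for \<open>b = B(\<lambda>\<^sub>1)\<close> and \<open>H\<close> the positive part of \<open>Q\<close>. Let
  \<open>\<lambda>\<^sub>i, p\<^sub>i\<close> and \<open>\<mu>\<^sub>k, q\<^sub>k\<close> be the ordered eigenvalues and eigenvectors of \<open>G\<close> and \<open>H\<close>. Beyond the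
  index \<open>r\<close>, raise \<open>\<lambda>\<^sub>i\<close> by \<open>b/2\<close> and clamp \<open>\<mu>\<^sub>k\<close> to \<open>[b/2, \<lambda>\<^sub>k + b/2]\<close>; by Weyl's inequality no
  eigenvalue moves by more than \<open>b/2\<close>, so the two changes together cost \<open>b/L\<close> in operator norm. The
  remaining difference is bounded in the Frobenius norm: if \<open>\<gamma>\<^sub>i\<close>, \<open>\<nu>\<^sub>k\<close> are the new eigenvalues, its
  square is at most \<open>L\<^sup>-\<^sup>2 \<Sum> (\<gamma>\<^sub>i - \<nu>\<^sub>k)\<^sup>2 \<langle>p\<^sub>i, q\<^sub>k\<rangle>\<^sup>2\<close>, where the weights are doubly stochastic and
  the rows and columns of \<open>(\<lambda>\<^sub>i - \<mu>\<^sub>k)\<^sup>2 \<langle>p\<^sub>i, q\<^sub>k\<rangle>\<^sup>2\<close> sum to at most \<open>b\<^sup>2\<close>. Splitting the shift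
  evenly between the two spectra is what yields the constant \<open>4\<close> in front of \<open>r b\<^sup>2\<close>: clamping
  only \<open>\<mu>\<^sub>k\<close> to \<open>[0, \<lambda>\<^sub>k]\<close> can leave as much as \<open>5 r b\<^sup>2\<close>.\<close>

section \<open>Diagonalization of symmetric matrices\<close>

text \<open>Variational argument: \<open>v\<close> maximizes the quadratic form on the unit sphere
  of \<open>S\<close>, and a first-order perturbation of \<open>v\<close> along the residual
  \<open>w = T v - m v\<close> would raise the form unless \<open>w = 0\<close>.\<close>

lemma symmetric_operator_eigenvector:
  fixes T :: "'a::euclidean_space \<Rightarrow> 'a"
  assumes lin: "linear T" and sym: "\<And>x y. x \<bullet> T y = T x \<bullet> y"
    and S: "subspace S" "T ` S \<subseteq> S" "S \<noteq> {0}"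
  obtains v m where "v \<in> S" "norm v = 1" "T v = m *\<^sub>R v"
proof -
  interpret linear T by (rule lin)
  have cont: "continuous_on (S \<inter> sphere 0 1) (\<lambda>x. x \<bullet> T x)"
    by (intro continuous_intros linear_continuous_on linear_linear[THEN iffD2] lin
        linear_conv_bounded_linear[THEN iffD1])
  have cpt: "compact (S \<inter> sphere 0 1)"
    using closed_subspace[OF S(1)] by (intro closed_Int_compact) auto
  obtain x0 where x0: "x0 \<in> S" "x0 \<noteq> 0"
    using S subspace_0 by auto
  then have "(1 / norm x0) *\<^sub>R x0 \<in> S \<inter> sphere 0 1"
    using S(1) by (auto simp: subspace_scale)
  then have "S \<inter> sphere 0 1 \<noteq> {}" by blast
  from continuous_attains_sup[OF cpt this cont] obtain v
    where v: "v \<in> S" "norm v = 1" and max: "\<And>y. y \<in> S \<Longrightarrow> norm y = 1 \<Longrightarrow> y \<bullet> T y \<le> v \<bullet> T v"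
    by auto
  define m where "m = v \<bullet> T v"
  have quad: "x \<bullet> T x \<le> m * (x \<bullet> x)" if "x \<in> S" for x
  proof (cases "x = 0")
    case False
    have "(1 / norm x) *\<^sub>R x \<in> S"
      using that S(1) by (auto simp: subspace_scale)
    from max[OF this] False have "(x \<bullet> T x) / (norm x)\<^sup>2 \<le> m"
      by (simp add: m_def scale power2_eq_square)
    then show ?thesis
      using False by (simp add: divide_le_eq power2_norm_eq_inner)
  qed simp
  define w where "w = T v - m *\<^sub>R v"
  have wS: "w \<in> S"
    unfolding w_def using S v by (auto intro!: subspace_diff subspace_scale)
  define c where "c = w \<bullet> w"
  define k where "k = m * (w \<bullet> w) - w \<bullet> T w"
  have vv: "v \<bullet> v = 1" using v(2) by (simp add: norm_eq_1)
  have c_eq: "c = w \<bullet> T v - m * (w \<bullet> v)"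
    by (subst c_def, subst (2) w_def) (simp add: inner_diff_right)
  \<comment> \<open>This is \<open>quad\<close> at \<open>v + t w\<close>, with the constant terms
    cancelled. The linear coefficient is twice \<open>c\<close>, the squared norm of the residual,
    so small positive \<open>t\<close> contradicts \<open>c > 0\<close>.\<close>
  have var: "2 * t * c \<le> t\<^sup>2 * k" for t
  proof -
    have "v + t *\<^sub>R w \<in> S"
      using S(1) v(1) wS by (simp add: subspace_add subspace_scale)
    from quad[OF this] have "m + 2 * t * (w \<bullet> T v) + t\<^sup>2 * (w \<bullet> T w)
        \<le> m * (1 + 2 * t * (w \<bullet> v) + t\<^sup>2 * (w \<bullet> w))"
      by (simp add: add scale inner_add_left inner_add_right vv m_def sym[of v w] inner_commute[of v w]
          inner_commute[of "T w" v] inner_commute[of "T v" w] power2_eq_square algebra_simps)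
    then show ?thesis
      by (simp add: c_eq k_def algebra_simps)
  qed
  have "c = 0"
  proof (rule ccontr)
    assume "c \<noteq> 0"
    then have c: "c > 0" by (simp add: c_def)
    \<comment> \<open>Small enough that \<open>t * k \<le> c\<close>, which is incompatible with
      \<open>2 * c \<le> t * k\<close>.\<close>
    define t where "t = c / (\<bar>k\<bar> + 1)"
    have t: "t > 0" using c by (simp add: t_def)
    have "2 * c \<le> t * k"
      using var[of t] t by (simp add: power2_eq_square)
    also have "\<dots> \<le> t * (\<bar>k\<bar> + 1)" using t by (intro mult_left_mono) auto
    also have "\<dots> = c" unfolding t_def by (simp add: field_simps add_nonneg_pos)
    finally show False using c by simp
  qed
  then have "T v = m *\<^sub>R v" by (simp add: c_def w_def)
  with v that show ?thesis by blast
qed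

text \<open>Induction on dimension: split off one unit eigenvector \<open>v\<close>. By symmetry of
  \<open>T\<close>, the part of \<open>S\<close> orthogonal to \<open>v\<close> is again invariant,
  which is why the claim is made for all invariant subspaces.\<close>

lemma symmetric_operator_eigenbasis:
  fixes T :: "'a::euclidean_space \<Rightarrow> 'a"
  assumes lin: "linear T" and sym: "\<And>x y. x \<bullet> T y = T x \<bullet> y"
    and "subspace S" "T ` S \<subseteq> S"
  shows "\<exists>B. B \<subseteq> S \<and> span B = S \<and> pairwise orthogonal B \<and>
    (\<forall>v\<in>B. norm v = 1 \<and> (\<exists>m. T v = m *\<^sub>R v))"
  using assms(3,4)
proof (induction "dim S" arbitrary: S rule: less_induct)
  case less
  interpret linear T by (rule lin)
  show ?case
  proof (cases "S = {0}")
    case True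
    then show ?thesis by (intro exI[of _ "{}"]) auto
  next
    case False
    from symmetric_operator_eigenvector[OF lin sym less.prems False]
    obtain v m where v: "v \<in> S" "norm v = 1" "T v = m *\<^sub>R v" by blast
    have vv: "v \<bullet> v = 1" using v(2) by (simp add: norm_eq_1)
    define S' where "S' = {x \<in> S. v \<bullet> x = 0}"
    have sub': "subspace S'"
      using less.prems(1) unfolding S'_def subspace_def by (auto simp: inner_add_right)
    have inv': "T ` S' \<subseteq> S'"
      using less.prems(2) by (auto simp: S'_def sym v)
    have "v \<notin> S'" using vv by (simp add: S'_def)
    with v(1) have "S' \<subset> S" unfolding S'_def by blast
    then have "dim S' < dim S"
      by (metis dim_psubset less.prems(1) span_eq_iff sub')
    from less.hyps[OF this sub' inv'] obtain B where
      B: "B \<subseteq> S'" "span B = S'" "pairwise orthogonal B"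
        "\<forall>v\<in>B. norm v = 1 \<and> (\<exists>m. T v = m *\<^sub>R v)" by blast
    show ?thesis
    proof (intro exI[of _ "insert v B"] conjI)
      show "insert v B \<subseteq> S" using v B by (auto simp: S'_def)
      then have "span (insert v B) \<subseteq> S"
        by (rule span_minimal) (rule less.prems)
      moreover have "x \<in> span (insert v B)" if "x \<in> S" for x
      proof -
        have "x - (v \<bullet> x) *\<^sub>R v \<in> S'"
          using that v less.prems(1) vv
          by (auto simp: S'_def subspace_diff subspace_scale inner_diff_right)
        then have "x - (v \<bullet> x) *\<^sub>R v \<in> span B" using B by simp
        then show ?thesis by (auto simp: span_insert)
      qed
      ultimately show "span (insert v B) = S" by blast
      show "pairwise orthogonal (insert v B)"
        using B by (auto simp: pairwise_insert S'_def orthogonal_def inner_commute)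
      show "\<forall>v\<in>insert v B. norm v = 1 \<and> (\<exists>m. T v = m *\<^sub>R v)"
        using B v by auto
    qed
  qed
qed

lemma matrix_vector_mult_column_sum:
  fixes U :: "real^'n^'n"
  shows "(U ** diag_matrix \<mu> ** transpose U) *v v = (\<Sum>j\<in>UNIV. \<mu> j *\<^sub>R (column j U \<bullet> v) *\<^sub>R column j U)"
proof -
  have "(diag_matrix \<mu> *v w) = (\<chi> j. \<mu> j * w $ j)" for w
    by (simp add: vec_eq_iff diag_matrix_def matrix_vector_mult_def if_distrib[where f = "\<lambda>x. x * _"] cong: if_cong)
  moreover have "transpose U *v v = (\<chi> j. column j U \<bullet> v)"
    by (simp add: vec_eq_iff matrix_vector_mult_def transpose_def column_def inner_vec_def)
  moreover have "U *v w = (\<Sum>j\<in>UNIV. w $ j *\<^sub>R column j U)" for w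
    by (simp add: matrix_mult_sum scalar_mult_eq_scaleR)
  ultimately show ?thesis
    by (simp add: matrix_vector_mul_assoc[symmetric])
qed

theorem symmetric_matrix_diagonalizable:
  fixes A :: "real^'n^'n"
  assumes "transpose A = A"
  shows "\<exists>U \<mu>. orthogonal_matrix U \<and> A = U ** diag_matrix \<mu> ** transpose U"
proof -
  have "x \<bullet> (A *v y) = (A *v x) \<bullet> y" for x y
    by (metis assms dot_lmul_matrix vector_transpose_matrix)
  from symmetric_operator_eigenbasis[OF matrix_vector_mul_linear this subspace_UNIV]
  obtain B where B: "span B = (UNIV :: (real^'n) set)" "pairwise orthogonal B"
    and eig: "\<And>v. v \<in> B \<Longrightarrow> norm v = 1" "\<And>v. v \<in> B \<Longrightarrow> \<exists>m. A *v v = m *\<^sub>R v"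
    by auto
  have ind: "independent B"
    using B(2) eig(1)[of 0] by (intro pairwise_orthogonal_independent) auto
  then have fin: "finite B" by (rule independent_imp_finite)
  have "card B = CARD('n)"
    using indep_card_eq_dim_span[OF ind] B(1) by simp
  \<comment> \<open>The eigenbasis is a set of the right cardinality; enumerating it by the index
    type turns its elements into the columns of \<open>U\<close>.\<close>
  then obtain b where b: "bij_betw b (UNIV :: 'n set) B"
    using fin finite_same_card_bij[of "UNIV :: 'n set" B] by auto
  define U where "U = (\<chi> i j. b j $ i)"
  have col: "column j U = b j" for j
    by (simp add: U_def column_def vec_eq_iff)
  have bB: "b j \<in> B" for j using b by (auto simp: bij_betw_def)
  have orth: "orthogonal_matrix U"
    unfolding orthogonal_matrix_orthonormal_columns col
    using B(2) eig(1) bB b by (auto simp: pairwise_def bij_betw_def inj_eq)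
  define \<mu> where "\<mu> j = (SOME m. A *v b j = m *\<^sub>R b j)" for j
  have \<mu>: "A *v b j = \<mu> j *\<^sub>R b j" for j
    unfolding \<mu>_def by (rule someI_ex[OF eig(2)[OF bB]])
  have "A *v v = (U ** diag_matrix \<mu> ** transpose U) *v v" for v
  proof -
    have "(\<Sum>x\<in>B. (v \<bullet> x) *\<^sub>R x) = v"
      by (rule orthonormal_basis_expand[OF B(2) eig(1)]) (simp_all add: B(1) fin)
    then have "(\<Sum>j\<in>UNIV. (v \<bullet> b j) *\<^sub>R b j) = v"
      using sum.reindex_bij_betw[OF b, of "\<lambda>x. (v \<bullet> x) *\<^sub>R x"] by (rule trans[rotated])
    then have "A *v v = A *v (\<Sum>j\<in>UNIV. (v \<bullet> b j) *\<^sub>R b j)" by (rule arg_cong[OF sym])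
    also have "\<dots> = (\<Sum>j\<in>UNIV. (v \<bullet> b j) *\<^sub>R (A *v b j))"
      by (simp add: linear_sum[OF matrix_vector_mul_linear] matrix_vector_mult_scaleR)
    also have "\<dots> = (\<Sum>j\<in>UNIV. \<mu> j *\<^sub>R (column j U \<bullet> v) *\<^sub>R column j U)"
      unfolding col \<mu> by (simp add: inner_commute mult.commute)
    finally show ?thesis by (simp add: matrix_vector_mult_column_sum)
  qed
  then have "A = U ** diag_matrix \<mu> ** transpose U"
    by (simp add: matrix_eq)
  with orth show ?thesis by blast
qed

text \<open>Diagonalizability makes the choice in \<open>matrix_fun\<close> meaningful. The
  decomposition obtained may vary with \<open>f\<close>, but it serves \<open>A\<close> and
  \<open>matrix_fun f A\<close> simultaneously.\<close>

lemma matrix_fun_decomposition: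
  fixes A :: "real^'n^'n"
  assumes "transpose A = A"
  obtains U \<mu> where "orthogonal_matrix U" "A = U ** diag_matrix \<mu> ** transpose U"
    "matrix_fun f A = U ** diag_matrix (\<lambda>i. f (\<mu> i)) ** transpose U"
proof -
  let ?P = "\<lambda>N. \<exists>U \<mu>. orthogonal_matrix U \<and> A = U ** diag_matrix \<mu> ** transpose U
      \<and> N = U ** diag_matrix (\<lambda>i. f (\<mu> i)) ** transpose U"
  have "\<exists>N. ?P N" using symmetric_matrix_diagonalizable[OF assms] by blast
  then have "?P (matrix_fun f A)" unfolding matrix_fun_def by (rule someI_ex)
  with that show ?thesis by blast
qed

text \<open>Regarded as a matrix of constant polynomials, \<open>U\<close> conjugates the diagonal
  matrix of the linear factors into \<open>x I - A\<close>; multiplicativity of \<open>det\<close>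
  finishes. This links \<open>eigenval\<close>, defined through roots, to the diagonal
  entries.\<close>

lemma characteristic_poly_diagonalized:
  fixes U :: "real^'n^'n"
  assumes "orthogonal_matrix U"
  shows "characteristic_poly (U ** diag_matrix \<mu> ** transpose U) = (\<Prod>i\<in>UNIV. [:- \<mu> i, 1:])"
proof -
  define P where "P = (\<chi> i j. [:U $ i $ j:])"
  define D where "D = (\<chi> i j. if i = j then [:- \<mu> i, 1:] else 0)"
  have sum_const: "(\<Sum>x\<in>S. [:h x:]) = [:\<Sum>x\<in>S. h x:]" for h :: "'n \<Rightarrow> real" and S
    by (induction S rule: infinite_finite_induct) auto
  have UU: "(\<Sum>k\<in>UNIV. U $ i $ k * U $ j $ k) = (if i = j then 1 else 0)" for i j
  proof -
    have "(U ** transpose U) $ i $ j = mat 1 $ i $ j"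
      using assms by (simp add: orthogonal_matrix_def)
    then show ?thesis by (simp add: matrix_matrix_mult_def transpose_def mat_def)
  qed
  have PP: "P ** transpose P = mat 1"
    by (auto simp: P_def matrix_matrix_mult_def transpose_def vec_eq_iff mat_def sum_const UU one_pCons)
  have entry: "(P ** D ** transpose P) $ i $ j = (\<Sum>k\<in>UNIV. [:U $ i $ k:] * [:- \<mu> k, 1:] * [:U $ j $ k:])" for i j
    by (simp add: P_def D_def matrix_matrix_mult_def transpose_def if_distrib[where f = "\<lambda>x. _ * x"] cong: if_cong)
  have sumX: "(\<Sum>k\<in>UNIV. [:g k, h k:]) = [:\<Sum>k\<in>UNIV. g k, \<Sum>k\<in>UNIV. h k:]" for g h :: "'n \<Rightarrow> real"
  proof -
    have "(\<Sum>k\<in>S. [:g k, h k:]) = [:\<Sum>k\<in>S. g k, \<Sum>k\<in>S. h k:]" for S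
      by (induction S rule: infinite_finite_induct) auto
    then show ?thesis .
  qed
  have A: "(U ** diag_matrix \<mu> ** transpose U) $ i $ j = (\<Sum>k\<in>UNIV. U $ i $ k * \<mu> k * U $ j $ k)" for i j
    by (simp add: diag_matrix_def matrix_matrix_mult_def transpose_def if_distrib[where f = "\<lambda>x. _ * x"] cong: if_cong)
  \<comment> \<open>Entrywise comparison of coefficients: orthogonality \<open>UU\<close> yields the
    identity as coefficient of \<open>x\<close>, and the constant coefficient is minus the
    diagonalized matrix.\<close>
  have "(\<chi> i j. (if i = j then [:0, 1:] else 0) - [:(U ** diag_matrix \<mu> ** transpose U) $ i $ j:]) = P ** D ** transpose P"
    unfolding vec_eq_iff entry
    by (auto simp: A sumX UU sum_negf mult.commute mult.left_commute)
  then have "characteristic_poly (U ** diag_matrix \<mu> ** transpose U) = det (P ** D ** transpose P)"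
    by (simp add: characteristic_poly_def)
  also have "\<dots> = det D * det (P ** transpose P)"
    by (simp add: det_mul)
  also have "\<dots> = det D" by (simp add: PP)
  also have "\<dots> = (\<Prod>i\<in>UNIV. [:- \<mu> i, 1:])"
    by (subst det_diagonal) (auto simp: D_def)
  finally show ?thesis .
qed

section \<open>Spectral perturbation\<close>

declare One_nat_def [simp del]

text \<open>The index range \<open>{1..DIM('a)}\<close> matches that of the ordered eigenvalues;
  values of \<open>p\<close> outside it are unconstrained.\<close>

definition orthonormal_family :: "(nat \<Rightarrow> 'a::euclidean_space) \<Rightarrow> bool" where
  "orthonormal_family p \<longleftrightarrow>
     (\<forall>i\<in>{1..DIM('a)}. \<forall>j\<in>{1..DIM('a)}. p i \<bullet> p j = (if i = j then 1 else 0))"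

definition spectral_op :: "(nat \<Rightarrow> 'a::euclidean_space) \<Rightarrow> (nat \<Rightarrow> real) \<Rightarrow> 'a \<Rightarrow> 'a" where
  "spectral_op p \<alpha> v = (\<Sum>i=1..DIM('a). (\<alpha> i * (p i \<bullet> v)) *\<^sub>R p i)"

lemma orthonormal_family_inner:
  fixes p :: "nat \<Rightarrow> 'a::euclidean_space"
  assumes "orthonormal_family p" "i \<in> {1..DIM('a)}" "j \<in> {1..DIM('a)}"
  shows "p i \<bullet> p j = (if i = j then 1 else 0)"
  using assms unfolding orthonormal_family_def by blast

lemma orthonormal_family_inj:
  fixes p :: "nat \<Rightarrow> 'a::euclidean_space"
  assumes "orthonormal_family p"
  shows "inj_on p {1..DIM('a)}"
proof (rule inj_onI)
  fix i j assume ij: "i \<in> {1..DIM('a)}" "j \<in> {1..DIM('a)}" "p i = p j"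
  have "p i \<bullet> p j = 1" using orthonormal_family_inner[OF assms ij(1) ij(1)] ij(3) by simp
  then show "i = j" using orthonormal_family_inner[OF assms ij(1,2)] by (metis zero_neq_one)
qed

lemma orthonormal_family_independent:
  fixes p :: "nat \<Rightarrow> 'a::euclidean_space"
  assumes p: "orthonormal_family p" and I: "I \<subseteq> {1..DIM('a)}"
  shows "independent (p ` I)" and "pairwise orthogonal (p ` I)" and "dim (span (p ` I)) = card I"
proof -
  show orth: "pairwise orthogonal (p ` I)"
  proof (rule pairwiseI)
    fix x y assume "x \<in> p ` I" "y \<in> p ` I" "x \<noteq> y"
    then obtain i j where "i \<in> I" "j \<in> I" "x = p i" "y = p j" "i \<noteq> j" by blast
    then show "orthogonal x y"
      using orthonormal_family_inner[OF p, of i j] I by (auto simp: orthogonal_def subset_iff)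
  qed
  have "0 \<notin> p ` I"
  proof
    assume "0 \<in> p ` I"
    then obtain i where "i \<in> I" "p i = 0" by force
    then show False using orthonormal_family_inner[OF p, of i i] I by (auto simp: subset_iff)
  qed
  with orth show ind: "independent (p ` I)" by (rule pairwise_orthogonal_independent)
  have "inj_on p I" using orthonormal_family_inj[OF p] I by (rule inj_on_subset)
  then show "dim (span (p ` I)) = card I"
    by (simp add: dim_eq_card_independent[OF ind] card_image)
qed

lemma orthonormal_family_expand:
  fixes p :: "nat \<Rightarrow> 'a::euclidean_space"
  assumes p: "orthonormal_family p"
  shows "(\<Sum>i=1..DIM('a). (p i \<bullet> v) *\<^sub>R p i) = v"
proof -
  let ?B = "p ` {1..DIM('a)}"
  have "dim (span ?B) = DIM('a)"
    by (subst orthonormal_family_independent(3)[OF p]) auto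
  then have "span ?B = UNIV" by (metis dim_eq_full dim_span)
  moreover have "norm x = 1" if x: "x \<in> ?B" for x
  proof -
    obtain i where "i \<in> {1..DIM('a)}" "x = p i" using x by blast
    then show ?thesis using orthonormal_family_inner[OF p, of i i] by (simp add: norm_eq_1)
  qed
  ultimately have "(\<Sum>x\<in>?B. (v \<bullet> x) *\<^sub>R x) = v"
    by (intro orthonormal_basis_expand orthonormal_family_independent(2)[OF p]) simp_all
  then show ?thesis
    by (simp add: sum.reindex[OF orthonormal_family_inj[OF p]] inner_commute)
qed

lemma norm_sum_orthonormal_family:
  fixes p :: "nat \<Rightarrow> 'a::euclidean_space"
  assumes p: "orthonormal_family p" and I: "I \<subseteq> {1..DIM('a)}"
  shows "(norm (\<Sum>i\<in>I. a i *\<^sub>R p i))\<^sup>2 = (\<Sum>i\<in>I. (a i)\<^sup>2)"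
proof -
  have fin: "finite I" using I by (rule finite_subset) simp
  have "(norm (\<Sum>i\<in>I. a i *\<^sub>R p i))\<^sup>2 = (\<Sum>i\<in>I. \<Sum>j\<in>I. a i * a j * (p j \<bullet> p i))"
    by (simp add: power2_norm_eq_inner inner_sum_left inner_sum_right inner_commute mult.assoc mult.left_commute)
  also have "\<dots> = (\<Sum>i\<in>I. \<Sum>j\<in>I. if j = i then (a i)\<^sup>2 else 0)"
    using I by (intro sum.cong refl) (auto simp: orthonormal_family_inner[OF p] subset_iff power2_eq_square)
  also have "\<dots> = (\<Sum>i\<in>I. (a i)\<^sup>2)" using fin by simp
  finally show ?thesis .
qed

lemma orthonormal_family_parseval:
  fixes p :: "nat \<Rightarrow> 'a::euclidean_space"
  assumes p: "orthonormal_family p"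
  shows "(\<Sum>i=1..DIM('a). (p i \<bullet> v)\<^sup>2) = (norm v)\<^sup>2"
  using norm_sum_orthonormal_family[OF p subset_refl, of "\<lambda>i. p i \<bullet> v"]
  by (simp add: orthonormal_family_expand[OF p])

lemma inner_spectral_op:
  fixes p :: "nat \<Rightarrow> 'a::euclidean_space"
  assumes p: "orthonormal_family p" and j: "j \<in> {1..DIM('a)}"
  shows "p j \<bullet> spectral_op p \<alpha> v = \<alpha> j * (p j \<bullet> v)"
proof -
  have "p j \<bullet> spectral_op p \<alpha> v = (\<Sum>i=1..DIM('a). if i = j then \<alpha> j * (p j \<bullet> v) else 0)"
    unfolding spectral_op_def inner_sum_right
    using j by (intro sum.cong refl) (auto simp: orthonormal_family_inner[OF p])
  then show ?thesis using j by simp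
qed

lemma spectral_op_basis:
  fixes p :: "nat \<Rightarrow> 'a::euclidean_space"
  assumes p: "orthonormal_family p" and j: "j \<in> {1..DIM('a)}"
  shows "spectral_op p \<alpha> (p j) = \<alpha> j *\<^sub>R p j"
proof -
  have "spectral_op p \<alpha> (p j) = (\<Sum>i=1..DIM('a). if i = j then \<alpha> j *\<^sub>R p j else 0)"
    unfolding spectral_op_def
    using j by (intro sum.cong refl) (auto simp: orthonormal_family_inner[OF p])
  then show ?thesis using j by simp
qed

lemma inner_self_spectral_op:
  "v \<bullet> spectral_op p \<alpha> v = (\<Sum>i=1..DIM('a). \<alpha> i * (p i \<bullet> v)\<^sup>2)" for v :: "'a::euclidean_space"
  by (simp add: spectral_op_def inner_sum_right inner_commute power2_eq_square mult.assoc)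

lemma linear_spectral_op: "linear (spectral_op p \<alpha>)"
  by (rule linearI)
    (simp_all add: spectral_op_def inner_add_right scaleR_left_distrib distrib_left sum.distrib
      scaleR_sum_right mult.left_commute)

lemma spectral_op_diff: "spectral_op p \<alpha> v - spectral_op p \<beta> v = spectral_op p (\<lambda>i. \<alpha> i - \<beta> i) v"
  by (simp add: spectral_op_def sum_subtractf[symmetric] scaleR_left_diff_distrib[symmetric] left_diff_distrib)

lemma norm_spectral_op_le:
  fixes p :: "nat \<Rightarrow> 'a::euclidean_space"
  assumes p: "orthonormal_family p" and c: "\<And>i. i \<in> {1..DIM('a)} \<Longrightarrow> \<bar>\<alpha> i\<bar> \<le> c"
  shows "norm (spectral_op p \<alpha> v) \<le> c * norm v"
proof (rule power2_le_imp_le)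
  have c0: "c \<ge> 0"
    using c[of 1] DIM_positive[where 'a='a] by force
  have "(norm (spectral_op p \<alpha> v))\<^sup>2 = (\<Sum>i=1..DIM('a). (\<alpha> i * (p i \<bullet> v))\<^sup>2)"
    unfolding spectral_op_def by (rule norm_sum_orthonormal_family[OF p subset_refl])
  also have "\<dots> \<le> (\<Sum>i=1..DIM('a). c\<^sup>2 * (p i \<bullet> v)\<^sup>2)"
    unfolding power_mult_distrib
    using c c0 by (intro sum_mono mult_right_mono) (auto simp: abs_le_square_iff[symmetric])
  also have "\<dots> = (c * norm v)\<^sup>2"
    by (simp add: sum_distrib_left[symmetric] orthonormal_family_parseval[OF p] power_mult_distrib)
  finally show "(norm (spectral_op p \<alpha> v))\<^sup>2 \<le> (c * norm v)\<^sup>2" .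
  show "0 \<le> c * norm v" using c0 by simp
qed

text \<open>Expand \<open>u\<close> in the basis \<open>q\<close> and apply Cauchy-Schwarz to the
  coefficients and the norms of the images.\<close>

lemma norm_linear_le_hilbert_schmidt:
  fixes q :: "nat \<Rightarrow> 'a::euclidean_space" and D :: "'a \<Rightarrow> 'b::real_normed_vector"
  assumes q: "orthonormal_family q" and D: "linear D"
  shows "norm (D u) \<le> sqrt (\<Sum>k=1..DIM('a). (norm (D (q k)))\<^sup>2) * norm u"
proof -
  interpret linear D by (rule D)
  have "norm (D u) = norm (D (\<Sum>k=1..DIM('a). (q k \<bullet> u) *\<^sub>R q k))"
    by (simp add: orthonormal_family_expand[OF q])
  also have "\<dots> = norm (\<Sum>k=1..DIM('a). (q k \<bullet> u) *\<^sub>R D (q k))"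
    by (simp add: sum scale)
  also have "\<dots> \<le> (\<Sum>k=1..DIM('a). \<bar>q k \<bullet> u\<bar> * \<bar>norm (D (q k))\<bar>)"
    by (rule order_trans[OF norm_sum]) simp
  also have "\<dots> \<le> L2_set (\<lambda>k. q k \<bullet> u) {1..DIM('a)} * L2_set (\<lambda>k. norm (D (q k))) {1..DIM('a)}"
    by (rule L2_set_mult_ineq)
  also have "\<dots> = sqrt (\<Sum>k=1..DIM('a). (norm (D (q k)))\<^sup>2) * norm u"
    by (simp add: L2_set_def orthonormal_family_parseval[OF q])
  finally show ?thesis .
qed

text \<open>The component of the difference along \<open>p i\<close> is
  \<open>(\<alpha> i - \<beta> k) * (p i \<bullet> q k)\<close>, and Parseval sums the squares.
  Differences of operators with different eigenbases thus become sums over pairs of eigenvalues,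
  weighted by the squared overlaps of the eigenvectors.\<close>

lemma norm_spectral_op_diff_basis:
  fixes p q :: "nat \<Rightarrow> 'a::euclidean_space"
  assumes p: "orthonormal_family p" and q: "orthonormal_family q" and k: "k \<in> {1..DIM('a)}"
  shows "(norm (spectral_op p \<alpha> (q k) - spectral_op q \<beta> (q k)))\<^sup>2
    = (\<Sum>i=1..DIM('a). (\<alpha> i - \<beta> k)\<^sup>2 * (p i \<bullet> q k)\<^sup>2)"
proof -
  let ?x = "spectral_op p \<alpha> (q k) - spectral_op q \<beta> (q k)"
  have "(norm ?x)\<^sup>2 = (\<Sum>i=1..DIM('a). (p i \<bullet> ?x)\<^sup>2)"
    by (rule orthonormal_family_parseval[OF p, symmetric])
  also have "\<dots> = (\<Sum>i=1..DIM('a). (\<alpha> i - \<beta> k)\<^sup>2 * (p i \<bullet> q k)\<^sup>2)"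
    by (intro sum.cong refl)
      (simp add: inner_diff_right inner_spectral_op[OF p] spectral_op_basis[OF q k]
        power_mult_distrib[symmetric] left_diff_distrib)
  finally show ?thesis .
qed

lemma norm_spectral_op_diff_le:
  fixes p q :: "nat \<Rightarrow> 'a::euclidean_space"
  assumes p: "orthonormal_family p" and q: "orthonormal_family q"
  shows "norm (spectral_op p \<alpha> u - spectral_op q \<beta> u)
    \<le> sqrt (\<Sum>i=1..DIM('a). \<Sum>k=1..DIM('a). (\<alpha> i - \<beta> k)\<^sup>2 * (p i \<bullet> q k)\<^sup>2) * norm u"
proof -
  have "linear (\<lambda>u. spectral_op p \<alpha> u - spectral_op q \<beta> u)"
    by (intro linear_compose_sub linear_spectral_op)
  from norm_linear_le_hilbert_schmidt[OF q this, of u] show ?thesis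
    by (subst sum.swap) (simp add: norm_spectral_op_diff_basis[OF p q])
qed

lemma spectral_op_symmetric: "u \<bullet> spectral_op p \<alpha> v = spectral_op p \<alpha> u \<bullet> v"
  by (simp add: spectral_op_def inner_sum_right inner_sum_left inner_commute mult.assoc mult.left_commute mult.commute)

text \<open>Polarization: the parallelogram law turns the bound on the quadratic form into one on the
  bilinear form.\<close>

lemma symmetric_norm_le_quadratic_bound:
  fixes D :: "'a::real_inner \<Rightarrow> 'a"
  assumes D: "linear D" and sym: "\<And>x y. x \<bullet> D y = D x \<bullet> y"
    and b: "\<And>x. \<bar>x \<bullet> D x\<bar> \<le> b * (norm x)\<^sup>2"
  shows "norm (D v) \<le> b * norm v"
proof (cases "D v = 0 \<or> v = 0")
  case True
  have "0 \<le> b * norm v"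
  proof (cases "v = 0")
    case False
    have "0 \<le> b * (norm v)\<^sup>2" using b[of v] by linarith
    then have "0 \<le> b" using False by (simp add: zero_le_mult_iff)
    then show ?thesis by simp
  qed simp
  then show ?thesis using True linear_0[OF D] by auto
next
  case False
  interpret linear D by (rule D)
  \<comment> \<open>\<open>D v\<close> rescaled to the length of \<open>v\<close>: then
    \<open>x \<bullet> D v\<close> is the product of the norms of \<open>v\<close> and
    \<open>D v\<close>, and the parallelogram law gives exactly four times the squared norm of
    \<open>v\<close>.\<close>
  define x where "x = (norm v / norm (D v)) *\<^sub>R D v"
  have nx: "norm x = norm v" using False by (simp add: x_def)
  have "x \<bullet> D v = norm v * norm (D v)"
    using False by (simp add: x_def power2_norm_eq_inner[symmetric] power2_eq_square)
  moreover have "4 * (x \<bullet> D v) = (x + v) \<bullet> D (x + v) - (x - v) \<bullet> D (x - v)"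
    using sym[of v x] by (simp add: add diff inner_add_left inner_add_right inner_diff_left inner_diff_right inner_commute)
  moreover have "(x + v) \<bullet> D (x + v) \<le> b * (norm (x + v))\<^sup>2" using b[of "x + v"] by linarith
  moreover have "- ((x - v) \<bullet> D (x - v)) \<le> b * (norm (x - v))\<^sup>2" using b[of "x - v"] by linarith
  moreover have "b * (norm (x + v))\<^sup>2 + b * (norm (x - v))\<^sup>2 = b * (4 * (norm v)\<^sup>2)"
    unfolding distrib_left[symmetric] using nx
    by (simp add: power2_norm_eq_inner inner_add_left inner_add_right inner_diff_left inner_diff_right norm_eq)
  ultimately have "norm v * norm (D v) \<le> norm v * (b * norm v)"
    by (simp add: power2_eq_square algebra_simps)
  then show ?thesis using False by simp
qed

text \<open>Weyl's inequality: by dimension count, the span of the top \<open>k\<close> eigenvectors of one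
  operator meets the span of the last \<open>d - k + 1\<close> eigenvectors of the other.\<close>

lemma weyl_inequality:
  fixes p q :: "nat \<Rightarrow> 'a::euclidean_space"
  assumes p: "orthonormal_family p" and q: "orthonormal_family q"
    and \<alpha>: "\<And>i j. 1 \<le> i \<Longrightarrow> i \<le> j \<Longrightarrow> j \<le> DIM('a) \<Longrightarrow> \<alpha> j \<le> \<alpha> i"
    and \<beta>: "\<And>i j. 1 \<le> i \<Longrightarrow> i \<le> j \<Longrightarrow> j \<le> DIM('a) \<Longrightarrow> \<beta> j \<le> \<beta> i"
    and b: "\<And>v. v \<bullet> spectral_op q \<beta> v \<le> v \<bullet> spectral_op p \<alpha> v + b * (norm v)\<^sup>2"
    and k: "k \<in> {1..DIM('a)}"
  shows "\<beta> k \<le> \<alpha> k + b"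
proof -
  let ?S = "span (q ` {1..k})" and ?T = "span (p ` {k..DIM('a)})"
  have "dim ?S = k" "dim ?T = DIM('a) - k + 1"
    using k by (simp_all add: orthonormal_family_independent(3)[OF q] orthonormal_family_independent(3)[OF p] subset_iff Suc_diff_le One_nat_def del: dim_span)
  moreover have "dim {x + y |x y. x \<in> ?S \<and> y \<in> ?T} + dim (?S \<inter> ?T) = dim ?S + dim ?T"
    by (intro dim_sums_Int) auto
  moreover have "dim {x + y |x y. x \<in> ?S \<and> y \<in> ?T} \<le> DIM('a)" by (rule dim_subset_UNIV)
  ultimately have "dim (?S \<inter> ?T) > 0" using k by auto
  then obtain v where v: "v \<in> ?S" "v \<in> ?T" "v \<noteq> 0"
    by (metis Int_iff dim_eq_0 less_numeral_extra(3) singleton_iff subsetI)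
  \<comment> \<open>Consequently \<open>v\<close> has \<open>q\<close>-coordinates only up to index
    \<open>k\<close> and \<open>p\<close>-coordinates only from \<open>k\<close> on. Its form is
    then at least \<open>\<beta> k\<close> times the squared norm for the first operator and at most
    \<open>\<alpha> k\<close> times it for the second.\<close>
  have zero: "f i \<bullet> v = 0" if f: "orthonormal_family f" and v: "v \<in> span (f ` I)"
    and I: "I \<subseteq> {1..DIM('a)}" and i: "i \<in> {1..DIM('a)} - I" for f :: "nat \<Rightarrow> 'a" and i I
  proof -
    have "orthogonal (f i) v"
    proof (rule orthogonal_to_span[OF v])
      fix y assume "y \<in> f ` I"
      then obtain j where "j \<in> I" "y = f j" by blast
      then show "orthogonal (f i) y"
        using orthonormal_family_inner[OF f, of i j] i I by (auto simp: orthogonal_def)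
    qed
    then show ?thesis by (simp add: orthogonal_def)
  qed
  have q0: "q i \<bullet> v = 0" if "i \<in> {1..DIM('a)}" "i > k" for i
    using zero[OF q v(1), of i] that k by auto
  have p0: "p i \<bullet> v = 0" if "i \<in> {1..DIM('a)}" "i < k" for i
    using zero[OF p v(2), of i] that k by auto
  have "\<beta> k * (norm v)\<^sup>2 = (\<Sum>i=1..DIM('a). \<beta> k * (q i \<bullet> v)\<^sup>2)"
    by (simp add: sum_distrib_left[symmetric] orthonormal_family_parseval[OF q])
  also have "\<dots> \<le> (\<Sum>i=1..DIM('a). \<beta> i * (q i \<bullet> v)\<^sup>2)"
  proof (rule sum_mono)
    fix i assume "i \<in> {1..DIM('a)}"
    then show "\<beta> k * (q i \<bullet> v)\<^sup>2 \<le> \<beta> i * (q i \<bullet> v)\<^sup>2"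
      using q0[of i] \<beta>[of i k] k by (cases "i > k") (auto intro!: mult_right_mono)
  qed
  also have "\<dots> = v \<bullet> spectral_op q \<beta> v" by (simp add: inner_self_spectral_op)
  also have "\<dots> \<le> v \<bullet> spectral_op p \<alpha> v + b * (norm v)\<^sup>2" by (rule b)
  also have "v \<bullet> spectral_op p \<alpha> v = (\<Sum>i=1..DIM('a). \<alpha> i * (p i \<bullet> v)\<^sup>2)"
    by (rule inner_self_spectral_op)
  also have "\<dots> \<le> (\<Sum>i=1..DIM('a). \<alpha> k * (p i \<bullet> v)\<^sup>2)"
  proof (rule sum_mono)
    fix i assume "i \<in> {1..DIM('a)}"
    then show "\<alpha> i * (p i \<bullet> v)\<^sup>2 \<le> \<alpha> k * (p i \<bullet> v)\<^sup>2"
      using p0[of i] \<alpha>[of k i] k by (cases "i < k") (auto intro!: mult_right_mono)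
  qed
  also have "\<dots> = \<alpha> k * (norm v)\<^sup>2"
    by (simp add: sum_distrib_left[symmetric] orthonormal_family_parseval[OF p])
  finally have "\<beta> k * (norm v)\<^sup>2 \<le> (\<alpha> k + b) * (norm v)\<^sup>2" by (simp add: distrib_right)
  then show ?thesis using v(3) by simp
qed

text \<open>Each squared difference is split into a term \<open>F\<close> charged to the row
  \<open>i\<close> and a term \<open>H\<close> charged to the column \<open>k\<close>. Rows up to
  \<open>r\<close> then cost \<open>9/4 b^2\<close> each, columns up to \<open>r\<close> cost
  \<open>3/2 b^2\<close> each, and every later row or column costs the square of its
  \<open>\<alpha>\<close>.\<close>

lemma weighted_double_sum_bound:
  fixes \<alpha> \<beta> :: "nat \<Rightarrow> real" and w :: "nat \<Rightarrow> nat \<Rightarrow> real"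
  assumes w: "\<And>i k. w i k \<ge> 0"
    and row: "\<And>i. i \<in> {1..n} \<Longrightarrow> (\<Sum>k=1..n. w i k) = 1"
    and col: "\<And>k. k \<in> {1..n} \<Longrightarrow> (\<Sum>i=1..n. w i k) = 1"
    and rowb: "\<And>i. i \<in> {1..n} \<Longrightarrow> (\<Sum>k=1..n. (\<alpha> i - \<beta> k)\<^sup>2 * w i k) \<le> b\<^sup>2"
    and colb: "\<And>k. k \<in> {1..n} \<Longrightarrow> (\<Sum>i=1..n. (\<alpha> i - \<beta> k)\<^sup>2 * w i k) \<le> b\<^sup>2"
    and nonneg: "\<And>i. i \<in> {1..n} \<Longrightarrow> \<alpha> i \<ge> 0" "\<And>i. i \<in> {1..n} \<Longrightarrow> \<beta> i \<ge> 0" "b \<ge> 0"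
    and r: "r \<in> {1..n}"
    and \<gamma>: "\<And>i. i \<le> r \<Longrightarrow> \<gamma> i = \<alpha> i" "\<And>i. i > r \<Longrightarrow> \<gamma> i = \<alpha> i + b / 2"
    and \<nu>: "\<And>k. k \<le> r \<Longrightarrow> \<nu> k = \<beta> k" "\<And>k. k > r \<Longrightarrow> k \<le> n \<Longrightarrow> \<bar>\<beta> k - \<nu> k\<bar> \<le> b / 2"
      "\<And>k. k > r \<Longrightarrow> k \<le> n \<Longrightarrow> \<nu> k \<in> {b / 2..\<alpha> k + b / 2}"
  shows "(\<Sum>i=1..n. \<Sum>k=1..n. (\<gamma> i - \<nu> k)\<^sup>2 * w i k) \<le> 4 * real r * b\<^sup>2 + 2 * (\<Sum>i=r+1..n. (\<alpha> i)\<^sup>2)"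
proof -
  define y where "y i k = (\<alpha> i - \<beta> k)\<^sup>2" for i k
  define F where "F i k = (if i \<le> r then (3/2) * y i k + (3/4) * b\<^sup>2 else (\<alpha> i)\<^sup>2)" for i k
  define H where "H i k = (if k \<le> r then y i k + b\<^sup>2 / 2 else (\<alpha> k)\<^sup>2)" for i k
  have tail: "(\<Sum>i=1..n. if i \<le> r then c else (\<alpha> i)\<^sup>2) = real r * c + (\<Sum>i=r+1..n. (\<alpha> i)\<^sup>2)" for c
  proof -
    have "(\<Sum>i=1..n. if i \<le> r then c else (\<alpha> i)\<^sup>2)
        = (\<Sum>i=1..r. if i \<le> r then c else (\<alpha> i)\<^sup>2) + (\<Sum>i=r+1..n. if i \<le> r then c else (\<alpha> i)\<^sup>2)"
      using r sum.ub_add_nat[of 1 r "\<lambda>i. if i \<le> r then c else (\<alpha> i)\<^sup>2" "n - r"] by simp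
    then show ?thesis by simp
  qed
  have pointwise: "(\<gamma> i - \<nu> k)\<^sup>2 \<le> F i k + H i k" if i: "i \<in> {1..n}" and k: "k \<in> {1..n}" for i k
  proof -
    have y0: "y i k \<ge> 0" by (simp add: y_def)
    consider "i \<le> r" "k \<le> r" | "i \<le> r" "k > r" | "i > r" "k \<le> r" | "i > r" "k > r" by linarith
    then show ?thesis
    proof cases
      case 1
      have "F i k + H i k = (5/2) * y i k + (5/4) * b\<^sup>2"
        using 1 by (simp add: F_def H_def)
      then have "y i k \<le> F i k + H i k" using y0 zero_le_power2[of b] by linarith
      then show ?thesis using 1 by (simp add: \<gamma> \<nu>(1) y_def)
    next
      case 2
      have "\<bar>\<beta> k - \<nu> k\<bar> \<le> b / 2"
        using 2 k \<nu>(2)[of k] by simp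
      then have "(\<beta> k - \<nu> k)\<^sup>2 \<le> (b / 2)\<^sup>2" by (rule power2_le_iff_abs_le[THEN iffD2, rotated]) (use nonneg in simp)
      \<comment> \<open>Weighted Young inequality \<open>(x + e)^2 \<le> 3/2 x^2 + 3 e^2\<close>
        with \<open>x = \<alpha> i - \<beta> k\<close> and \<open>e = \<beta> k - \<nu> k\<close>;
        as \<open>e\<close> is at most \<open>b / 2\<close> in absolute value, the second term is at
        most \<open>3/4 b^2\<close>.\<close>
      moreover have "0 \<le> (\<alpha> i - \<beta> k - 2 * (\<beta> k - \<nu> k))\<^sup>2" by simp
      ultimately have "(\<alpha> i - \<nu> k)\<^sup>2 \<le> (3/2) * y i k + (3/4) * b\<^sup>2"
        by (simp add: y_def power2_eq_square algebra_simps)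
      then show ?thesis using 2 by (simp add: \<gamma> F_def H_def add_increasing2)
    next
      case 3
      have "(\<alpha> i + b / 2 - \<beta> k)\<^sup>2 = y i k + b\<^sup>2 / 4 + b * \<alpha> i - b * \<beta> k"
        by (simp add: y_def power2_eq_square field_simps)
      moreover have "b * \<beta> k \<ge> 0" using nonneg k by simp
      \<comment> \<open>Gives \<open>b * \<alpha> i \<le> (\<alpha> i)^2 + b^2 / 4\<close>,
        absorbing the cross term produced by the shift.\<close>
      moreover have "0 \<le> (\<alpha> i - b / 2)\<^sup>2" by simp
      ultimately have "(\<alpha> i + b / 2 - \<beta> k)\<^sup>2 \<le> (\<alpha> i)\<^sup>2 + (y i k + b\<^sup>2 / 2)"
        by (simp add: power2_eq_square field_simps)
      then show ?thesis using 3 by (simp add: \<gamma> \<nu>(1) F_def H_def)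
    next
      case 4
      \<comment> \<open>Beyond \<open>r\<close> in both indices the two shifts by
        \<open>b / 2\<close> cancel, leaving the difference of \<open>\<alpha> i\<close> and a
        number between \<open>0\<close> and \<open>\<alpha> k\<close>.\<close>
      define z where "z = \<nu> k - b / 2"
      have z: "0 \<le> z" "z \<le> \<alpha> k"
        using 4 k \<nu>(3)[of k] by (auto simp: z_def)
      then have "z\<^sup>2 \<le> (\<alpha> k)\<^sup>2" by (intro power_mono) auto
      moreover have "0 \<le> \<alpha> i * z" using z nonneg(1)[OF i] by simp
      ultimately have "(\<alpha> i - z)\<^sup>2 \<le> (\<alpha> i)\<^sup>2 + (\<alpha> k)\<^sup>2" by (simp add: power2_diff)
      then show ?thesis using 4 by (simp add: \<gamma> F_def H_def z_def algebra_simps)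
    qed
  qed
  have "(\<Sum>i=1..n. \<Sum>k=1..n. (\<gamma> i - \<nu> k)\<^sup>2 * w i k) \<le> (\<Sum>i=1..n. \<Sum>k=1..n. (F i k + H i k) * w i k)"
    by (intro sum_mono mult_right_mono pointwise w)
  also have "\<dots> = (\<Sum>i=1..n. \<Sum>k=1..n. F i k * w i k) + (\<Sum>k=1..n. \<Sum>i=1..n. H i k * w i k)"
    by (subst (3) sum.swap) (simp add: distrib_right sum.distrib)
  also have "(\<Sum>i=1..n. \<Sum>k=1..n. F i k * w i k) \<le> (\<Sum>i=1..n. if i \<le> r then (9/4) * b\<^sup>2 else (\<alpha> i)\<^sup>2)"
  proof (rule sum_mono)
    fix i assume i: "i \<in> {1..n}"
    show "(\<Sum>k=1..n. F i k * w i k) \<le> (if i \<le> r then (9/4) * b\<^sup>2 else (\<alpha> i)\<^sup>2)"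
    proof (cases "i \<le> r")
      case True
      have "(\<Sum>k=1..n. F i k * w i k) = (3/2) * (\<Sum>k=1..n. (\<alpha> i - \<beta> k)\<^sup>2 * w i k) + (3/4) * b\<^sup>2 * (\<Sum>k=1..n. w i k)"
        using True by (simp add: F_def y_def distrib_right sum.distrib sum_distrib_left mult.assoc)
      then show ?thesis using True rowb[OF i] row[OF i] by simp
    next
      case False
      then show ?thesis using row[OF i] by (simp add: F_def sum_distrib_left[symmetric])
    qed
  qed
  also have "(\<Sum>k=1..n. \<Sum>i=1..n. H i k * w i k) \<le> (\<Sum>k=1..n. if k \<le> r then (3/2) * b\<^sup>2 else (\<alpha> k)\<^sup>2)"
  proof (rule sum_mono)
    fix k assume k: "k \<in> {1..n}"
    show "(\<Sum>i=1..n. H i k * w i k) \<le> (if k \<le> r then (3/2) * b\<^sup>2 else (\<alpha> k)\<^sup>2)"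
    proof (cases "k \<le> r")
      case True
      have "(\<Sum>i=1..n. H i k * w i k) = (\<Sum>i=1..n. (\<alpha> i - \<beta> k)\<^sup>2 * w i k) + b\<^sup>2 / 2 * (\<Sum>i=1..n. w i k)"
        using True by (simp add: H_def y_def distrib_right sum.distrib sum_distrib_left)
      then show ?thesis using True colb[OF k] col[OF k] by simp
    next
      case False
      then show ?thesis using col[OF k] by (simp add: H_def sum_distrib_left[symmetric])
    qed
  qed
  \<comment> \<open>The constants add up to \<open>9/4 + 3/2 = 15/4\<close>, which is below
    \<open>4\<close>.\<close>
  also have "(\<Sum>i=1..n. if i \<le> r then (9/4) * b\<^sup>2 else (\<alpha> i)\<^sup>2) + (\<Sum>k=1..n. if k \<le> r then (3/2) * b\<^sup>2 else (\<alpha> k)\<^sup>2)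
      \<le> 4 * real r * b\<^sup>2 + 2 * (\<Sum>i=r+1..n. (\<alpha> i)\<^sup>2)"
    unfolding tail by (simp add: algebra_simps)
  finally show ?thesis by simp
qed

section \<open>Ordered eigensystems and the deterministic perturbation bound\<close>

text \<open>The columns of \<open>U\<close> are renumbered so that the diagonal entries decrease; by
  the factored characteristic polynomial these entries are exactly the \<open>eigenval\<close> list.
  One family \<open>p\<close>, possibly depending on \<open>f\<close>, diagonalizes both
  \<open>A\<close> and \<open>matrix_fun f A\<close>.\<close>

lemma symmetric_matrix_eigensystem:
  fixes A :: "real^'n^'n"
  assumes "transpose A = A"
  obtains p where "orthonormal_family p"
    "\<And>i j. 1 \<le> i \<Longrightarrow> i \<le> j \<Longrightarrow> j \<le> CARD('n) \<Longrightarrow> eigenval A j \<le> eigenval A i"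
    "\<And>v. A *v v = spectral_op p (eigenval A) v"
    "\<And>v. matrix_fun f A *v v = spectral_op p (\<lambda>i. f (eigenval A i)) v"
proof -
  obtain U \<mu> where U: "orthogonal_matrix U" and A: "A = U ** diag_matrix \<mu> ** transpose U"
    and fA: "matrix_fun f A = U ** diag_matrix (\<lambda>i. f (\<mu> i)) ** transpose U"
    using matrix_fun_decomposition[OF assms] by blast
  obtain ys where ys: "set ys = (UNIV :: 'n set)" "distinct ys"
    using finite_distinct_list[of "UNIV :: 'n set"] by auto
  \<comment> \<open>Sorting the indices by the negated entries lists them from largest to smallest
    entry, matching the reversal in \<open>eigenval\<close>; the later shift \<open>i - 1\<close>
    passes from positions starting at 1 to list positions.\<close>
  define xs where "xs = sort_key (\<lambda>j. - \<mu> j) ys"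
  have xs: "set xs = UNIV" "distinct xs" "sorted (map (\<lambda>j. - \<mu> j) xs)"
    using ys by (simp_all add: xs_def)
  have len: "length xs = CARD('n)" using xs distinct_card by fastforce
  define e where "e i = xs ! (i - 1)" for i
  have "bij_betw (\<lambda>i. i - 1) {1..CARD('n)} {..<CARD('n)}"
    by (rule bij_betw_byWitness[where f' = Suc]) auto
  from bij_betw_trans[OF this bij_betw_nth[OF xs(2) refl refl, unfolded len xs(1)]]
  have e: "bij_betw e {1..CARD('n)} UNIV" by (simp add: e_def[abs_def] o_def)
  have "proots (characteristic_poly A) = mset (map \<mu> xs)"
  proof -
    have "proots (characteristic_poly A) = (\<Sum>i\<in>UNIV. proots [:- \<mu> i, 1:])"
      unfolding A characteristic_poly_diagonalized[OF U] by (subst proots_prod) auto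
    also have "\<dots> = (\<Sum>i\<in>UNIV. {#\<mu> i#})" by simp
    also have "\<dots> = image_mset \<mu> (mset_set UNIV)"
    proof -
      have "(\<Sum>i\<in>S. {#\<mu> i#}) = image_mset \<mu> (mset_set S)" for S :: "'n set"
        by (induction S rule: infinite_finite_induct) auto
      then show ?thesis .
    qed
    also have "mset_set UNIV = mset xs" using xs by (metis mset_set_set)
    finally show ?thesis by simp
  qed
  moreover have "sorted (rev (map \<mu> xs))"
    using xs(3) unfolding rev_map[symmetric] by (simp add: sorted_wrt_map sorted_wrt_rev)
  ultimately have *: "sorted_list_of_multiset (proots (characteristic_poly A)) = rev (map \<mu> xs)"
    by (simp add: sorted_list_of_multiset_mset properties_for_sort del: mset_map)
  have ev: "eigenval A i = \<mu> (e i)" if "i \<in> {1..CARD('n)}" for i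
  proof -
    have "i - 1 < length xs" using that len by auto
    then show ?thesis by (simp add: eigenval_def e_def *)
  qed
  define p where "p i = column (e i) U" for i
  have spec: "(U ** diag_matrix (\<lambda>i. g (\<mu> i)) ** transpose U) *v v = spectral_op p (\<lambda>i. g (eigenval A i)) v" for g v
  proof -
    have "(U ** diag_matrix (\<lambda>i. g (\<mu> i)) ** transpose U) *v v
        = (\<Sum>i=1..CARD('n). (g (\<mu> (e i)) * (p i \<bullet> v)) *\<^sub>R p i)"
      unfolding matrix_vector_mult_column_sum p_def by (subst sum.reindex_bij_betw[OF e, symmetric]) simp
    also have "\<dots> = spectral_op p (\<lambda>i. g (eigenval A i)) v"
      unfolding spectral_op_def by (intro sum.cong) (simp_all add: ev)
    finally show ?thesis .
  qed
  show thesis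
  proof (rule that)
    have "e i = e j \<longleftrightarrow> i = j" if "i \<in> {1..CARD('n)}" "j \<in> {1..CARD('n)}" for i j
      using e that by (auto simp: bij_betw_def inj_on_eq_iff)
    moreover have "column a U \<bullet> column b U = (if a = b then 1 else 0)" for a b
      using U unfolding orthogonal_matrix_orthonormal_columns
      by (auto simp: orthogonal_def norm_eq_1)
    ultimately show "orthonormal_family p"
      unfolding orthonormal_family_def p_def by simp
    show "eigenval A j \<le> eigenval A i" if "1 \<le> i" "i \<le> j" "j \<le> CARD('n)" for i j
    proof -
      have "map (\<lambda>j. - \<mu> j) xs ! (i - 1) \<le> map (\<lambda>j. - \<mu> j) xs ! (j - 1)"
        using xs(3) that len by (intro sorted_nth_mono) auto
      then show ?thesis using that len by (simp add: ev e_def)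
    qed
    show "A *v v = spectral_op p (eigenval A) v" for v
      using spec[of "\<lambda>x. x" v] by (simp add: A[symmetric])
    show "matrix_fun f A *v v = spectral_op p (\<lambda>i. f (eigenval A i)) v" for v
      unfolding fA by (rule spec)
  qed
qed

theorem operator_norm_lipschitz_matrix_fun_diff:
  fixes G H :: "real^'n^'n"
  assumes symG: "transpose G = G" and symH: "transpose H = H"
    and psdG: "\<And>v. 0 \<le> v \<bullet> (G *v v)" and psdH: "\<And>v. 0 \<le> v \<bullet> (H *v v)"
    and quad: "\<And>v. \<bar>v \<bullet> (H *v v) - v \<bullet> (G *v v)\<bar> \<le> b * (norm v)\<^sup>2"
    and r: "r \<in> {1..CARD('n)}" and L: "L > 0" and lip: "(1 / L)-lipschitz_on UNIV f"
  shows "operator_norm (matrix_fun f G - matrix_fun f H)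
    \<le> inverse L * (b + sqrt (4 * real r * b\<^sup>2 + 2 * (\<Sum>i=r+1..CARD('n). (eigenval G i)\<^sup>2)))"
proof -
  let ?n = "CARD('n)"
  define \<alpha> where "\<alpha> = eigenval G"
  define \<beta> where "\<beta> = eigenval H"
  obtain p where p: "orthonormal_family p"
    and \<alpha>_mono: "\<And>i j. 1 \<le> i \<Longrightarrow> i \<le> j \<Longrightarrow> j \<le> ?n \<Longrightarrow> \<alpha> j \<le> \<alpha> i"
    and G: "\<And>v. G *v v = spectral_op p \<alpha> v"
    and fG: "\<And>v. matrix_fun f G *v v = spectral_op p (\<lambda>i. f (\<alpha> i)) v"
    using symmetric_matrix_eigensystem[OF symG] unfolding \<alpha>_def by blast
  obtain q where q: "orthonormal_family q"
    and \<beta>_mono: "\<And>i j. 1 \<le> i \<Longrightarrow> i \<le> j \<Longrightarrow> j \<le> ?n \<Longrightarrow> \<beta> j \<le> \<beta> i"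
    and H: "\<And>v. H *v v = spectral_op q \<beta> v"
    and fH: "\<And>v. matrix_fun f H *v v = spectral_op q (\<lambda>i. f (\<beta> i)) v"
    using symmetric_matrix_eigensystem[OF symH] unfolding \<beta>_def by blast
  have norm_p: "p i \<bullet> p i = 1" and norm_q: "q i \<bullet> q i = 1" if "i \<in> {1..?n}" for i
    using that orthonormal_family_inner[OF p, of i i] orthonormal_family_inner[OF q, of i i] by simp_all
  have \<alpha>0: "\<alpha> i \<ge> 0" and \<beta>0: "\<beta> i \<ge> 0" if "i \<in> {1..?n}" for i
    using that psdG[of "p i"] psdH[of "q i"]
    by (simp_all add: G H spectral_op_basis[OF p] spectral_op_basis[OF q] norm_p norm_q)
  have b0: "b \<ge> 0"
    using quad[of "p r"] norm_p[OF r] by (simp add: power2_norm_eq_inner)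
  have weyl: "\<beta> k \<le> \<alpha> k + b" if "k \<in> {1..?n}" for k
  proof (rule weyl_inequality[OF p q])
    show "v \<bullet> spectral_op q \<beta> v \<le> v \<bullet> spectral_op p \<alpha> v + b * (norm v)\<^sup>2" for v
      using quad[of v] by (simp add: G H)
  qed (use that \<alpha>_mono \<beta>_mono in auto)
  have diff_le: "norm (spectral_op p \<alpha> v - spectral_op q \<beta> v) \<le> b * norm v" for v
  proof -
    have "linear (\<lambda>v. spectral_op p \<alpha> v - spectral_op q \<beta> v)"
      by (intro linear_compose_sub linear_spectral_op)
    then show ?thesis
    proof (rule symmetric_norm_le_quadratic_bound)
      show "x \<bullet> (spectral_op p \<alpha> y - spectral_op q \<beta> y) = (spectral_op p \<alpha> x - spectral_op q \<beta> x) \<bullet> y" for x y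
        by (simp add: inner_diff_left inner_diff_right spectral_op_symmetric)
      show "\<bar>x \<bullet> (spectral_op p \<alpha> x - spectral_op q \<beta> x)\<bar> \<le> b * (norm x)\<^sup>2" for x
        using quad[of x] by (simp add: inner_diff_right G H abs_minus_commute)
    qed
  qed
  define \<gamma> where "\<gamma> i = (if i \<le> r then \<alpha> i else \<alpha> i + b / 2)" for i
  define \<nu> where "\<nu> k = (if k \<le> r then \<beta> k else max (b / 2) (min (\<beta> k) (\<alpha> k + b / 2)))" for k
  have \<gamma>_dist: "\<bar>\<alpha> i - \<gamma> i\<bar> \<le> b / 2" for i
    using b0 by (simp add: \<gamma>_def)
  \<comment> \<open>Lowering \<open>\<beta> k\<close> to \<open>\<alpha> k + b / 2\<close> costs at
    most \<open>b / 2\<close> by \<open>weyl\<close>; raising it to \<open>b / 2\<close> costs at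
    most that much because \<open>\<beta> k\<close> is nonnegative.\<close>
  have \<nu>_dist: "\<bar>\<nu> k - \<beta> k\<bar> \<le> b / 2" if "k \<in> {1..?n}" for k
    using b0 weyl[OF that] \<alpha>0[OF that] \<beta>0[OF that] by (auto simp: \<nu>_def max_def min_def)
  define T where "T = (\<Sum>i=1..?n. \<Sum>k=1..?n. (\<gamma> i - \<nu> k)\<^sup>2 * (p i \<bullet> q k)\<^sup>2)"
  have T: "T \<le> 4 * real r * b\<^sup>2 + 2 * (\<Sum>i=r+1..?n. (\<alpha> i)\<^sup>2)"
    unfolding T_def
  proof (rule weighted_double_sum_bound[where \<beta> = \<beta>])
    show "(\<Sum>k=1..?n. (p i \<bullet> q k)\<^sup>2) = 1" if "i \<in> {1..?n}" for i
      using orthonormal_family_parseval[OF q, of "p i"] norm_p[OF that]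
      by (simp add: power2_norm_eq_inner inner_commute)
    show "(\<Sum>i=1..?n. (p i \<bullet> q k)\<^sup>2) = 1" if "k \<in> {1..?n}" for k
      using orthonormal_family_parseval[OF p, of "q k"] norm_q[OF that]
      by (simp add: power2_norm_eq_inner)
    \<comment> \<open>A row sum is the squared norm of \<open>G - H\<close> applied to
      \<open>p i\<close>, read off in the basis \<open>q\<close>; column sums arise likewise from
      \<open>q k\<close>.\<close>
    show "(\<Sum>k=1..?n. (\<alpha> i - \<beta> k)\<^sup>2 * (p i \<bullet> q k)\<^sup>2) \<le> b\<^sup>2" if "i \<in> {1..?n}" for i
    proof -
      have "(norm (spectral_op p \<alpha> (p i) - spectral_op q \<beta> (p i)))\<^sup>2 \<le> b\<^sup>2"
        using diff_le[of "p i"] norm_p[OF that] by (intro power_mono) (simp_all add: norm_eq_1[THEN iffD2])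
      then show ?thesis
        using norm_spectral_op_diff_basis[OF q p, of i \<beta> \<alpha>] that
        by (simp add: norm_minus_commute inner_commute power2_commute)
    qed
    show "(\<Sum>i=1..?n. (\<alpha> i - \<beta> k)\<^sup>2 * (p i \<bullet> q k)\<^sup>2) \<le> b\<^sup>2" if "k \<in> {1..?n}" for k
    proof -
      have "(norm (spectral_op p \<alpha> (q k) - spectral_op q \<beta> (q k)))\<^sup>2 \<le> b\<^sup>2"
        using diff_le[of "q k"] norm_q[OF that] by (intro power_mono) (simp_all add: norm_eq_1[THEN iffD2])
      then show ?thesis
        using norm_spectral_op_diff_basis[OF p q, of k \<alpha> \<beta>] that by simp
    qed
    show "\<nu> k \<in> {b / 2..\<alpha> k + b / 2}" if "k > r" "k \<le> ?n" for k
      using that r \<alpha>0[of k] by (auto simp: \<nu>_def)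
    show "\<bar>\<beta> k - \<nu> k\<bar> \<le> b / 2" if "k > r" "k \<le> ?n" for k
      using that r \<nu>_dist[of k] by (simp add: abs_minus_commute)
  qed (use \<alpha>0 \<beta>0 b0 r in \<open>simp_all add: \<gamma>_def \<nu>_def\<close>)
  have f: "\<bar>f x - f y\<bar> \<le> \<bar>x - y\<bar> / L" for x y
    using lipschitz_onD[OF lip, of x y] by (simp add: dist_real_def)
  let ?e = "sqrt (4 * real r * b\<^sup>2 + 2 * (\<Sum>i=r+1..?n. (\<alpha> i)\<^sup>2))"
  have "norm ((matrix_fun f G - matrix_fun f H) *v u) \<le> inverse L * (b + ?e) * norm u" for u
  proof -
    \<comment> \<open>Path from \<open>f(G)\<close> to \<open>f(H)\<close>: first change the
      eigenvalues of \<open>G\<close>, then exchange the eigenbasis, then undo the change in the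
      eigenvalues of \<open>H\<close>. The outer moves are bounded in operator norm, the middle one
      by the Frobenius norm.\<close>
    let ?A = "spectral_op p (\<lambda>i. f (\<alpha> i)) u" and ?B = "spectral_op p (\<lambda>i. f (\<gamma> i)) u"
      and ?C = "spectral_op q (\<lambda>i. f (\<nu> i)) u" and ?D = "spectral_op q (\<lambda>i. f (\<beta> i)) u"
    have "norm (?A - ?B) \<le> b / 2 / L * norm u"
      unfolding spectral_op_diff
      by (intro norm_spectral_op_le[OF p] order_trans[OF f] divide_right_mono \<gamma>_dist less_imp_le[OF L])
    moreover have "norm (?C - ?D) \<le> b / 2 / L * norm u"
      unfolding spectral_op_diff
      by (intro norm_spectral_op_le[OF q] order_trans[OF f] divide_right_mono \<nu>_dist less_imp_le[OF L]) simp
    moreover have "norm (?B - ?C) \<le> ?e / L * norm u"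
    proof -
      have "(\<Sum>i=1..?n. \<Sum>k=1..?n. (f (\<gamma> i) - f (\<nu> k))\<^sup>2 * (p i \<bullet> q k)\<^sup>2)
          \<le> (\<Sum>i=1..?n. \<Sum>k=1..?n. ((\<gamma> i - \<nu> k)\<^sup>2 / L\<^sup>2) * (p i \<bullet> q k)\<^sup>2)"
      proof (intro sum_mono mult_right_mono)
        fix i k
        have "\<bar>f (\<gamma> i) - f (\<nu> k)\<bar>\<^sup>2 \<le> (\<bar>\<gamma> i - \<nu> k\<bar> / L)\<^sup>2"
          by (intro power_mono f) simp
        then show "(f (\<gamma> i) - f (\<nu> k))\<^sup>2 \<le> (\<gamma> i - \<nu> k)\<^sup>2 / L\<^sup>2"
          by (simp add: power_divide)
      qed simp
      also have "\<dots> = T / L\<^sup>2" by (simp add: T_def sum_divide_distrib)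
      also have "\<dots> \<le> (4 * real r * b\<^sup>2 + 2 * (\<Sum>i=r+1..?n. (\<alpha> i)\<^sup>2)) / L\<^sup>2"
        using T by (rule divide_right_mono) simp
      finally have "sqrt (\<Sum>i=1..?n. \<Sum>k=1..?n. (f (\<gamma> i) - f (\<nu> k))\<^sup>2 * (p i \<bullet> q k)\<^sup>2)
          \<le> sqrt ((4 * real r * b\<^sup>2 + 2 * (\<Sum>i=r+1..?n. (\<alpha> i)\<^sup>2)) / L\<^sup>2)"
        by (rule real_sqrt_le_mono)
      also have "\<dots> = ?e / L" using L by (simp only: real_sqrt_divide real_sqrt_abs abs_of_pos)
      finally have "sqrt (\<Sum>i=1..?n. \<Sum>k=1..?n. (f (\<gamma> i) - f (\<nu> k))\<^sup>2 * (p i \<bullet> q k)\<^sup>2) \<le> ?e / L" .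
      from mult_right_mono[OF this norm_ge_zero[of u]] norm_spectral_op_diff_le[OF p q, of "\<lambda>i. f (\<gamma> i)" u "\<lambda>k. f (\<nu> k)"]
      show ?thesis by simp
    qed
    moreover have "norm (?A - ?D) \<le> norm (?A - ?B) + norm (?B - ?C) + norm (?C - ?D)"
      using norm_triangle_ineq[of "?A - ?C" "?C - ?D"] norm_triangle_ineq[of "?A - ?B" "?B - ?C"] by simp
    ultimately have "norm (?A - ?D) \<le> b / 2 / L * norm u + ?e / L * norm u + b / 2 / L * norm u" by linarith
    also have "\<dots> = inverse L * (b + ?e) * norm u" using L by (simp add: field_simps)
    finally show ?thesis by (simp add: matrix_vector_mult_diff_rdistrib fG fH)
  qed
  then show ?thesis unfolding operator_norm_def \<alpha>_def by (rule onorm_le)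
qed

section \<open>Gram matrices and the error bound\<close>

lemma rayleigh_quotient_le_eigenval:
  fixes A :: "real^'n^'n"
  assumes "transpose A = A"
  shows "v \<bullet> (A *v v) \<le> eigenval A 1 * (norm v)\<^sup>2"
    and "\<exists>u. norm u = 1 \<and> u \<bullet> (A *v u) = eigenval A 1"
proof -
  obtain p where p: "orthonormal_family p"
    and mono: "\<And>i j. 1 \<le> i \<Longrightarrow> i \<le> j \<Longrightarrow> j \<le> CARD('n) \<Longrightarrow> eigenval A j \<le> eigenval A i"
    and A: "\<And>v. A *v v = spectral_op p (eigenval A) v"
    using symmetric_matrix_eigensystem[OF assms] by metis
  have "v \<bullet> (A *v v) = (\<Sum>i=1..CARD('n). eigenval A i * (p i \<bullet> v)\<^sup>2)"
    by (simp add: A inner_self_spectral_op)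
  also have "\<dots> \<le> (\<Sum>i=1..CARD('n). eigenval A 1 * (p i \<bullet> v)\<^sup>2)"
    by (intro sum_mono mult_right_mono mono) auto
  also have "\<dots> = eigenval A 1 * (norm v)\<^sup>2"
    using orthonormal_family_parseval[OF p, of v] by (simp add: sum_distrib_left[symmetric])
  finally show "v \<bullet> (A *v v) \<le> eigenval A 1 * (norm v)\<^sup>2" .
  have 1: "(1::nat) \<in> {1..DIM(real^'n)}" by (simp add: One_nat_def Suc_le_eq)
  have "p 1 \<bullet> p 1 = 1" using orthonormal_family_inner[OF p 1 1] by simp
  then show "\<exists>u. norm u = 1 \<and> u \<bullet> (A *v u) = eigenval A 1"
    unfolding A norm_eq_1
    by (intro exI[of _ "p 1"] conjI) (simp_all only: spectral_op_basis[OF p 1] inner_scaleR_right mult_1_right)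
qed

lemma
  fixes A :: "real^'n^'n"
  assumes "transpose A = A"
  shows transpose_positive_part: "transpose (positive_part A) = positive_part A"
    and positive_part_nonneg: "0 \<le> v \<bullet> (positive_part A *v v)"
proof -
  obtain U \<mu> where "orthogonal_matrix U" "A = U ** diag_matrix \<mu> ** transpose U"
    and "matrix_fun (\<lambda>x. max x 0) A = U ** diag_matrix (\<lambda>i. max (\<mu> i) 0) ** transpose U"
    by (rule matrix_fun_decomposition[OF assms])
  then have pp: "positive_part A = U ** diag_matrix (\<lambda>i. max (\<mu> i) 0) ** transpose U"
    by (simp only: positive_part_def)
  have "transpose (diag_matrix d) = diag_matrix d" for d :: "'n \<Rightarrow> real"
    by (simp add: vec_eq_iff transpose_def diag_matrix_def)
  then show "transpose (positive_part A) = positive_part A"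
    by (simp add: pp matrix_transpose_mul matrix_mul_assoc)
  show "0 \<le> v \<bullet> (positive_part A *v v)"
    unfolding pp matrix_vector_mult_column_sum inner_sum_right
  proof (rule sum_nonneg)
    fix j
    have "0 \<le> max (\<mu> j) 0 * (column j U \<bullet> v)\<^sup>2" by simp
    then show "0 \<le> v \<bullet> max (\<mu> j) 0 *\<^sub>R (column j U \<bullet> v) *\<^sub>R column j U"
      by (simp add: inner_commute power2_eq_square mult.assoc)
  qed
qed

lemma transpose_gram: "transpose (gram M X) = gram M X"
  by (simp add: gram_def transpose_def vec_eq_iff mult.commute)

lemma power2_le_1_plus_power4: "(x::real)\<^sup>2 \<le> 1 + x ^ 4"
proof -
  have "0 \<le> (x\<^sup>2 - 1)\<^sup>2" by simp
  then have "2 * x\<^sup>2 \<le> 1 + x ^ 4" by (simp add: power2_diff power_mult[symmetric])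
  then show ?thesis using zero_le_power2[of x] by linarith
qed

context prob_space
begin

context
  fixes X :: "'a \<Rightarrow> real^'d"
  assumes X: "X \<in> borel_measurable M" and X4: "integrable M (\<lambda>\<omega>. norm (X \<omega>) ^ 4)"
begin

lemma integrable_norm_power2: "integrable M (\<lambda>\<omega>. (norm (X \<omega>))\<^sup>2)"
proof (rule Bochner_Integration.integrable_bound)
  show "integrable M (\<lambda>\<omega>. 1 + norm (X \<omega>) ^ 4)" using X4 by simp
  show "(\<lambda>\<omega>. (norm (X \<omega>))\<^sup>2) \<in> borel_measurable M" using X by measurable
  show "AE \<omega> in M. norm ((norm (X \<omega>))\<^sup>2) \<le> norm (1 + norm (X \<omega>) ^ 4)"
    by (intro always_eventually allI) (simp add: power2_le_1_plus_power4 abs_of_nonneg add_nonneg_nonneg)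
qed

lemma integrable_component_mult: "integrable M (\<lambda>\<omega>. X \<omega> $ i * X \<omega> $ j)"
proof (rule Bochner_Integration.integrable_bound[OF integrable_norm_power2])
  have "(\<lambda>\<omega>. X \<omega> $ k) \<in> borel_measurable M" for k
    unfolding cart_eq_inner_axis using X by measurable
  then show "(\<lambda>\<omega>. X \<omega> $ i * X \<omega> $ j) \<in> borel_measurable M" by measurable
  show "AE \<omega> in M. norm (X \<omega> $ i * X \<omega> $ j) \<le> norm ((norm (X \<omega>))\<^sup>2)"
    by (intro always_eventually allI)
      (simp add: abs_mult power2_eq_square mult_mono component_le_norm_cart)
qed

lemma inner_gram: "\<theta> \<bullet> (gram M X *v \<theta>) = expectation (\<lambda>\<omega>. (\<theta> \<bullet> X \<omega>)\<^sup>2)"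
proof -
  have "expectation (\<lambda>\<omega>. (\<theta> \<bullet> X \<omega>)\<^sup>2)
      = expectation (\<lambda>\<omega>. \<Sum>i\<in>UNIV. \<Sum>j\<in>UNIV. \<theta> $ i * \<theta> $ j * (X \<omega> $ i * X \<omega> $ j))"
    by (simp add: inner_vec_def power2_eq_square sum_product mult.assoc mult.left_commute)
  also have "\<dots> = (\<Sum>i\<in>UNIV. \<Sum>j\<in>UNIV. \<theta> $ i * \<theta> $ j * expectation (\<lambda>\<omega>. X \<omega> $ i * X \<omega> $ j))"
    by (simp add: Bochner_Integration.integral_sum integrable_component_mult)
  also have "\<dots> = \<theta> \<bullet> (gram M X *v \<theta>)"
    by (simp add: inner_vec_def matrix_vector_mult_def gram_def sum_distrib_left mult.assoc mult.left_commute mult.commute)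
  finally show ?thesis by simp
qed

lemma inner_gram_nonneg: "0 \<le> \<theta> \<bullet> (gram M X *v \<theta>)"
  by (simp add: inner_gram)

text \<open>Cauchy-Schwarz bounds the top eigenvalue by the second moment of the norm, and
  nonnegativity of a variance bounds that by \<open>s4_sq\<close>. Hence the minimum inside
  \<open>B_bound\<close> at the top eigenvalue is the eigenvalue itself.\<close>

lemma eigenval_gram_le_s4_sq: "eigenval (gram M X) 1 \<le> s4_sq M X"
proof -
  obtain u where u: "norm u = 1" "u \<bullet> (gram M X *v u) = eigenval (gram M X) 1"
    using rayleigh_quotient_le_eigenval(2)[OF transpose_gram] by blast
  have "expectation (\<lambda>\<omega>. (u \<bullet> X \<omega>)\<^sup>2) \<le> expectation (\<lambda>\<omega>. (norm (X \<omega>))\<^sup>2)"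
  proof (rule integral_mono_AE'[OF integrable_norm_power2])
    show "AE \<omega> in M. (u \<bullet> X \<omega>)\<^sup>2 \<le> (norm (X \<omega>))\<^sup>2"
    proof (intro always_eventually allI)
      fix \<omega>
      have "\<bar>u \<bullet> X \<omega>\<bar> \<le> norm (X \<omega>)" using Cauchy_Schwarz_ineq2[of u "X \<omega>"] u by simp
      from power_mono[OF this abs_ge_zero, of 2] show "(u \<bullet> X \<omega>)\<^sup>2 \<le> (norm (X \<omega>))\<^sup>2" by simp
    qed
  qed simp
  also have "\<dots> \<le> s4_sq M X"
    unfolding s4_sq_def
  proof (rule real_le_rsqrt)
    have "0 \<le> variance (\<lambda>\<omega>. (norm (X \<omega>))\<^sup>2)" by (rule variance_positive)
    also have "\<dots> = expectation (\<lambda>\<omega>. norm (X \<omega>) ^ 4) - (expectation (\<lambda>\<omega>. (norm (X \<omega>))\<^sup>2))\<^sup>2"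
      by (subst variance_eq) (simp_all add: integrable_norm_power2 X4 power_mult[symmetric])
    finally show "(expectation (\<lambda>\<omega>. (norm (X \<omega>))\<^sup>2))\<^sup>2 \<le> expectation (\<lambda>\<omega>. norm (X \<omega>) ^ 4)" by simp
  qed
  finally show ?thesis using u by (simp add: inner_gram)
qed

end

end

section \<open>Monotonicity of the error bound\<close>

lemma c_const_pos: "c_const > 0"
  unfolding c_const_def by (intro mult_pos_pos divide_pos_pos) simp_all

text \<open>\<open>ln\<close> is even and vanishes at \<open>0\<close>, so this holds even if the integer is not positive.\<close>

lemma ln_of_int_div_nonneg:
  assumes "0 < \<epsilon>" "\<epsilon> < 1"
  shows "0 \<le> ln (real_of_int k / \<epsilon>)"
proof (cases "k = 0")
  case False
  have *: "ln (real_of_int k / \<epsilon>) = ln (\<bar>real_of_int k\<bar> / \<epsilon>)"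
    using ln_minus[of "real_of_int k / \<epsilon>"] by (simp add: abs_if)
  have "1 \<le> \<bar>real_of_int k\<bar>" using False by linarith
  then show ?thesis unfolding * using assms by (intro ln_ge_zero) (simp add: le_divide_eq)
qed simp

text \<open>\<open>Q / t + R\<close> decreases in \<open>t\<close>, while
  \<open>t * (Q / t + R) = Q + R t\<close> increases. Both square roots in \<open>zeta\<close> have
  this shape.\<close>

lemma sqrt_affine_inverse_scaling:
  assumes "0 < u" "u \<le> v" "0 \<le> P" "0 \<le> Q" "0 \<le> (R::real)"
  shows "sqrt (P * (Q / v + R)) \<le> sqrt (P * (Q / u + R))"
    and "sqrt (u / v) * sqrt (P * (Q / u + R)) \<le> sqrt (P * (Q / v + R))"
proof -
  have "Q / v \<le> Q / u" using assms by (intro divide_left_mono) auto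
  then show "sqrt (P * (Q / v + R)) \<le> sqrt (P * (Q / u + R))"
    using assms by (intro real_sqrt_le_mono mult_left_mono) auto
  have "u / v * (P * (Q / u + R)) = P * (Q / v + u / v * R)"
    using assms by (simp add: field_simps)
  also have "\<dots> \<le> P * (Q / v + 1 * R)"
    using assms by (intro mult_left_mono add_left_mono mult_right_mono) (auto simp: divide_le_eq)
  finally show "sqrt (u / v) * sqrt (P * (Q / u + R)) \<le> sqrt (P * (Q / v + R))"
    unfolding real_sqrt_mult[symmetric] by (simp add: real_sqrt_le_mono)
qed

lemma zeta_scaling:
  assumes \<kappa>: "kurtosis M X \<ge> 1" and s4: "s4_sq M X \<ge> 0" and \<epsilon>: "0 < \<epsilon>" "\<epsilon> < 1"
    and uv: "0 < u" "u \<le> v"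
  shows "0 \<le> zeta M X n a \<epsilon> u" and "zeta M X n a \<epsilon> v \<le> zeta M X n a \<epsilon> u"
    and "sqrt (u / v) * zeta M X n a \<epsilon> u \<le> zeta M X n a \<epsilon> v"
proof -
  define P where "P = 2 * (kurtosis M X - 1)"
  define Q where "Q = (2 + 3 * c_const) * s4_sq M X / (4 * (2 + c_const) * sqrt (kurtosis M X))"
  define R where "R = ln (real_of_int (K_const M X n a) / \<epsilon>)"
  define S where "S = 2 * (2 + c_const) * sqrt (kurtosis M X) * s4_sq M X"
  \<comment> \<open>The second root is put in the same shape, with \<open>P = 1\<close> and
    \<open>R = 0\<close>.\<close>
  have zeta: "zeta M X n a \<epsilon> t = sqrt (P * (Q / t + R)) * cosh (a / 4) + sqrt (1 * (S / t + 0)) * cosh (a / 2)" for t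
    by (simp add: zeta_def P_def Q_def R_def S_def)
  have nn: "0 \<le> P" "0 \<le> Q" "0 \<le> R" "0 \<le> S"
    using \<kappa> s4 c_const_pos ln_of_int_div_nonneg[OF \<epsilon>] by (auto simp: P_def Q_def R_def S_def)
  note cosh0 = less_imp_le[OF cosh_real_pos]
  show "0 \<le> zeta M X n a \<epsilon> u"
    unfolding zeta using nn uv by (intro add_nonneg_nonneg mult_nonneg_nonneg cosh0 real_sqrt_ge_zero) auto
  show "zeta M X n a \<epsilon> v \<le> zeta M X n a \<epsilon> u"
    unfolding zeta by (intro add_mono mult_right_mono cosh0 sqrt_affine_inverse_scaling(1)[OF uv] nn) simp_all
  show "sqrt (u / v) * zeta M X n a \<epsilon> u \<le> zeta M X n a \<epsilon> v"
    unfolding zeta distrib_left[of "sqrt (u / v)"] mult.assoc[symmetric]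
    by (intro add_mono mult_right_mono cosh0 sqrt_affine_inverse_scaling(2)[OF uv] nn) simp_all
qed

text \<open>With \<open>s = sqrt (u / v)\<close> the claim is compared at the intermediate point
  \<open>s * x \<le> y\<close>. What remains reduces to
  \<open>(1 - s) * (1 - 4 x (1 + s)) \<ge> 0\<close>, true because \<open>s \<le> 1\<close> and
  \<open>x \<le> 1 / 8\<close>.\<close>

lemma mult_fraction_mono_of_scaling:
  fixes u v x y :: real
  assumes uv: "0 < u" "u \<le> v" and x: "0 \<le> x" "x \<le> 1 / 8" and y: "0 \<le> y" "y \<le> 1 / 8" "sqrt (u / v) * x \<le> y"
  shows "u * (x / (1 - 4 * x)) \<le> v * (y / (1 - 4 * y))"
proof -
  define s where "s = sqrt (u / v)"
  have s: "0 \<le> s" "s \<le> 1" using uv by (simp_all add: s_def)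
  have "s\<^sup>2 = u / v" unfolding s_def using uv by (intro real_sqrt_pow2) simp
  then have u: "u = v * s\<^sup>2" using uv by simp
  have sx: "s * x \<le> y" using y by (simp add: s_def)
  have sx0: "0 \<le> s * x" using s x by simp
  have "s * x \<le> 1 / 8" using sx y by linarith
  moreover have "0 \<le> (s * x) * ((1 - s) * (1 - 4 * x * (1 + s)))"
  proof (intro mult_nonneg_nonneg sx0)
    have "x * (1 + s) \<le> 1 / 8 * 2" using s x by (intro mult_mono) auto
    then show "0 \<le> 1 - 4 * x * (1 + s)" by simp
  qed (use s x in auto)
  then have "s\<^sup>2 * x * (1 - 4 * (s * x)) \<le> (s * x) * (1 - 4 * x)"
    by (simp add: power2_eq_square algebra_simps)
  ultimately have "s\<^sup>2 * x / (1 - 4 * x) \<le> (s * x) / (1 - 4 * (s * x))"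
    using x by (intro frac_le_eq[THEN iffD2]) (auto simp: divide_le_0_iff mult.commute)
  also have "\<dots> \<le> y / (1 - 4 * y)"
    using sx sx0 y by (intro frac_le) auto
  finally have "v * (s\<^sup>2 * x / (1 - 4 * x)) \<le> v * (y / (1 - 4 * y))"
    using uv by (intro mult_left_mono) auto
  then show ?thesis by (simp add: u)
qed

text \<open>The infinite branch of \<open>B_star\<close> never occurs here, so all estimates can be
  made in the reals. Monotonicity holds although \<open>zeta\<close> decreases, since by
  \<open>zeta_scaling\<close> it decreases no faster than the inverse square root.\<close>

lemma B_star_finite_mono:
  assumes \<kappa>: "kurtosis M X \<ge> 3 / 2" and s4: "s4_sq M X \<ge> 0" and \<epsilon>: "0 < \<epsilon>" "\<epsilon> < 1"
    and \<sigma>: "0 < \<sigma>" and n: "8 * zeta M X n a \<epsilon> \<sigma> \<le> sqrt (real n)"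
  obtains \<beta> where "\<And>t. B_star M X n a \<epsilon> \<sigma> t = ereal (\<beta> t)" "\<And>t. 0 \<le> \<beta> t"
    "\<And>s t. s \<le> t \<Longrightarrow> max s \<sigma> * \<beta> s \<le> max t \<sigma> * \<beta> t"
proof -
  define x where "x t = zeta M X n a \<epsilon> (max t \<sigma>) / sqrt (real n)" for t
  have \<kappa>1: "kurtosis M X \<ge> 1" using \<kappa> by simp
  note scaling = zeta_scaling[OF \<kappa>1 s4 \<epsilon>, where n = n and a = a]
  have z: "0 \<le> zeta M X n a \<epsilon> (max t \<sigma>)" "zeta M X n a \<epsilon> (max t \<sigma>) \<le> zeta M X n a \<epsilon> \<sigma>" for t
    using scaling(1)[of "max t \<sigma>" "max t \<sigma>"] scaling(2)[of \<sigma> "max t \<sigma>"] \<sigma> by auto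
  have x: "0 \<le> x t" "x t \<le> 1 / 8" for t
    using z[of t] n by (simp_all add: x_def divide_le_eq)
  show thesis
  proof (rule that[of "\<lambda>t. x t / (1 - 4 * x t)"])
    show "0 \<le> x t / (1 - 4 * x t)" for t using x[of t] by simp
    show "B_star M X n a \<epsilon> \<sigma> t = ereal (x t / (1 - 4 * x t))" for t
    proof -
      \<comment> \<open>The bound \<open>3 / 2\<close> on the kurtosis makes the factor in
        \<open>B_star\<close> at most \<open>6 + 2 = 8\<close>, the constant in the assumption on
        \<open>zeta\<close>.\<close>
      have "inverse (kurtosis M X - 1) \<le> inverse (1 / 2)"
        using \<kappa> by (intro le_imp_inverse_le) auto
      then have "(6 + inverse (kurtosis M X - 1)) * zeta M X n a \<epsilon> (max t \<sigma>) \<le> 8 * zeta M X n a \<epsilon> (max t \<sigma>)"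
        using z(1)[of t] by (intro mult_right_mono) auto
      also have "\<dots> \<le> sqrt (real n)" using z(2)[of t] n by linarith
      finally show ?thesis by (simp add: B_star_def Let_def x_def)
    qed
    show "max s \<sigma> * (x s / (1 - 4 * x s)) \<le> max t \<sigma> * (x t / (1 - 4 * x t))" if "s \<le> t" for s t
    proof (rule mult_fraction_mono_of_scaling)
      have "sqrt (max s \<sigma> / max t \<sigma>) * zeta M X n a \<epsilon> (max s \<sigma>) \<le> zeta M X n a \<epsilon> (max t \<sigma>)"
        using that \<sigma> by (intro scaling(3)) auto
      from divide_right_mono[OF this, of "sqrt (real n)"]
      show "sqrt (max s \<sigma> / max t \<sigma>) * x s \<le> x t" by (simp add: x_def)
    qed (use that \<sigma> x in auto)
  qed
qed

section \<open>From the estimator's event to the perturbation bound\<close>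

theorem proposition5p2:
  fixes M :: "'a measure"
    and X :: "'a \<Rightarrow> real^'d"
    and Xs :: "nat \<Rightarrow> 'a \<Rightarrow> real^'d"
    and n :: nat
    and a \<delta> \<epsilon> \<sigma> :: real
    and est :: "(nat \<Rightarrow> real^'d) \<Rightarrow> real^'d^'d"
    and Q :: "'a \<Rightarrow> real^'d^'d"
  assumes "prob_space M"
    and "X \<in> borel_measurable M"
    and "integrable M (\<lambda>\<omega>. norm (X \<omega>) ^ 4)"
    and "prob_space.indep_vars M (\<lambda>_. borel) Xs {1..n}"
    and "\<And>i. i \<in> {1..n} \<Longrightarrow> distr M borel (Xs i) = distr M borel X"
    and "a > 0" and "\<delta> > 0" and "0 < \<epsilon>" and "\<epsilon> < 1"
    and "est \<in> borel_measurable (PiM {1..n} (\<lambda>_. borel))"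
    and "\<And>\<omega>. \<omega> \<in> space M \<Longrightarrow> Q \<omega> = est (\<lambda>i\<in>{1..n}. Xs i \<omega>)"
    and "\<And>\<omega>. \<omega> \<in> space M \<Longrightarrow> transpose (Q \<omega>) = Q \<omega>"
    and "estimator_property M X n a \<epsilon> \<delta> \<sigma> Q"
    and "8 * zeta M X n a \<epsilon> \<sigma> \<le> sqrt (real n)"
    and "0 < \<sigma>" and "\<sigma> \<le> s4_sq M X"
    and "kurtosis M X \<ge> 3 / 2"
  shows "\<exists>A \<in> sets M. measure M A \<ge> 1 - 2 * \<epsilon> \<and>
    (\<forall>\<omega> \<in> A. \<forall>L > 0. \<forall>f. (1 / L)-lipschitz_on UNIV f \<longrightarrow>
      ereal (operator_norm (matrix_fun f (gram M X) - matrix_fun f (positive_part (Q \<omega>))))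
      \<le> Min ((\<lambda>r. ereal (inverse L) *
            (B_bound M X n a \<epsilon> \<delta> \<sigma> (eigenval (gram M X) 1)
             + ereal_sqrt (ereal (4 * real r) * (B_bound M X n a \<epsilon> \<delta> \<sigma> (eigenval (gram M X) 1))\<^sup>2
                 + ereal (2 * (\<Sum>i = r+1..CARD('d). (eigenval (gram M X) i)\<^sup>2)))))
          ` {1..CARD('d)}))"
proof -
  interpret prob_space M by fact
  let ?G = "gram M X"
  let ?l = "eigenval ?G 1"
  note X = \<open>X \<in> borel_measurable M\<close> \<open>integrable M (\<lambda>\<omega>. norm (X \<omega>) ^ 4)\<close>
  note symG = transpose_gram[of M X] and psdG = inner_gram_nonneg[OF X]
  have s4: "0 \<le> s4_sq M X" using \<open>0 < \<sigma>\<close> \<open>\<sigma> \<le> s4_sq M X\<close> by simp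
  obtain \<beta> where \<beta>: "\<And>t. B_star M X n a \<epsilon> \<sigma> t = ereal (\<beta> t)" "\<And>t. 0 \<le> \<beta> t"
    "\<And>s t. s \<le> t \<Longrightarrow> max s \<sigma> * \<beta> s \<le> max t \<sigma> * \<beta> t"
    using B_star_finite_mono[OF \<open>kurtosis M X \<ge> 3 / 2\<close> s4 \<open>0 < \<epsilon>\<close> \<open>\<epsilon> < 1\<close> \<open>0 < \<sigma>\<close>
        \<open>8 * zeta M X n a \<epsilon> \<sigma> \<le> sqrt (real n)\<close>] by blast
  define F where "F = frobenius_norm ?G"
  define b where "b = 2 * max ?l \<sigma> * \<beta> ?l + 7 * \<delta> * F + \<sigma>"
  have B_bound: "B_bound M X n a \<epsilon> \<delta> \<sigma> ?l = ereal b"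
    using eigenval_gram_le_s4_sq[OF X] by (simp add: B_bound_def \<beta>(1) b_def F_def min_absorb1)
  obtain A where A: "A \<in> sets M" "measure M A \<ge> 1 - 2 * \<epsilon>"
    and est: "\<And>\<omega> \<theta>. \<omega> \<in> A \<Longrightarrow> norm \<theta> = 1 \<Longrightarrow>
      \<bar>max (\<theta> \<bullet> (positive_part (Q \<omega>) *v \<theta>)) \<sigma> - max (\<theta> \<bullet> (?G *v \<theta>)) \<sigma>\<bar>
        \<le> 2 * max (\<theta> \<bullet> (?G *v \<theta>)) \<sigma> * \<beta> (\<theta> \<bullet> (?G *v \<theta>)) + 7 * \<delta> * F"
    using \<open>estimator_property M X n a \<epsilon> \<delta> \<sigma> Q\<close> \<open>8 * zeta M X n a \<epsilon> \<sigma> \<le> sqrt (real n)\<close>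
      \<open>\<sigma> \<le> s4_sq M X\<close> \<open>kurtosis M X \<ge> 3 / 2\<close>
    unfolding estimator_property_def Let_def \<beta>(1) F_def[symmetric] by auto
  have main: "operator_norm (matrix_fun f ?G - matrix_fun f (positive_part (Q \<omega>)))
      \<le> inverse L * (b + sqrt (4 * real r * b\<^sup>2 + 2 * (\<Sum>i=r+1..CARD('d). (eigenval ?G i)\<^sup>2)))"
    if \<omega>: "\<omega> \<in> A" and L: "L > 0" "(1 / L)-lipschitz_on UNIV f" and r: "r \<in> {1..CARD('d)}" for \<omega> L f r
  proof (rule operator_norm_lipschitz_matrix_fun_diff[OF symG _ psdG _ _ r L])
    have "\<omega> \<in> space M" using A(1) \<omega> sets.sets_into_space by blast
    then have symQ: "transpose (Q \<omega>) = Q \<omega>" by fact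
    show "transpose (positive_part (Q \<omega>)) = positive_part (Q \<omega>)" by (rule transpose_positive_part[OF symQ])
    show psdH: "0 \<le> v \<bullet> (positive_part (Q \<omega>) *v v)" for v by (rule positive_part_nonneg[OF symQ])
    show "\<bar>v \<bullet> (positive_part (Q \<omega>) *v v) - v \<bullet> (?G *v v)\<bar> \<le> b * (norm v)\<^sup>2" for v
    proof (cases "v = 0")
      case False
      define \<theta> where "\<theta> = (1 / norm v) *\<^sub>R v"
      have \<theta>: "norm \<theta> = 1" and v: "v = norm v *\<^sub>R \<theta>" using False by (simp_all add: \<theta>_def)
      let ?h = "\<theta> \<bullet> (positive_part (Q \<omega>) *v \<theta>)" and ?g = "\<theta> \<bullet> (?G *v \<theta>)"
      \<comment> \<open>Monotonicity replaces the direction-dependent error by its value at the top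
        eigenvalue, uniformly in \<open>\<theta>\<close>.\<close>
      have "?g \<le> ?l" using rayleigh_quotient_le_eigenval(1)[OF symG, of \<theta>] \<theta> by simp
      from \<beta>(3)[OF this] have "2 * max ?g \<sigma> * \<beta> ?g \<le> 2 * max ?l \<sigma> * \<beta> ?l" by simp
      \<comment> \<open>For nonnegative numbers, removing the truncation at \<open>\<sigma>\<close>
        costs at most \<open>\<sigma>\<close>; this is the last summand of
        \<open>B_bound\<close>.\<close>
      moreover have "\<bar>?h - ?g\<bar> \<le> \<bar>max ?h \<sigma> - max ?g \<sigma>\<bar> + \<sigma>"
        using psdH[of \<theta>] psdG[of \<theta>] \<open>0 < \<sigma>\<close> by (auto simp: max_def)
      ultimately have "\<bar>?h - ?g\<bar> \<le> b" using est[OF \<omega> \<theta>] by (simp add: b_def)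
      moreover have "v \<bullet> (C *v v) = (norm v)\<^sup>2 * (\<theta> \<bullet> (C *v \<theta>))" for C
        by (subst (1 2) v) (simp add: matrix_vector_mult_scaleR power2_eq_square)
      then have "\<bar>v \<bullet> (positive_part (Q \<omega>) *v v) - v \<bullet> (?G *v v)\<bar> = \<bar>?h - ?g\<bar> * (norm v)\<^sup>2"
        by (simp add: right_diff_distrib[symmetric] abs_mult mult.commute)
      ultimately show ?thesis by (simp add: mult_right_mono)
    qed simp
  qed
  show ?thesis
  \<comment> \<open>The estimator's event serves all \<open>L\<close> and \<open>f\<close> at once,
    because \<open>main\<close> is deterministic on it.\<close>
  proof (intro bexI[of _ A] conjI ballI allI impI A)
    fix \<omega> and L :: real and f :: "real \<Rightarrow> real" assume *: "\<omega> \<in> A" "0 < L" "(1 / L)-lipschitz_on UNIV f"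
    show "ereal (operator_norm (matrix_fun f ?G - matrix_fun f (positive_part (Q \<omega>))))
      \<le> Min ((\<lambda>r. ereal (inverse L) *
            (B_bound M X n a \<epsilon> \<delta> \<sigma> ?l
             + ereal_sqrt (ereal (4 * real r) * (B_bound M X n a \<epsilon> \<delta> \<sigma> ?l)\<^sup>2
                 + ereal (2 * (\<Sum>i = r+1..CARD('d). (eigenval ?G i)\<^sup>2)))))
          ` {1..CARD('d)})"
    proof -
      have "1 \<le> CARD('d)" by (simp add: One_nat_def Suc_le_eq)
      then show ?thesis
        using main[OF *] by (subst Min_ge_iff) (auto simp: B_bound ereal_sqrt_def power2_eq_square)
    qed
  qed
qed

end
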